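(* Let $\bar M$ be a real submanifold of $\mathbb{C}P^n$ of real dimension $\bar m$ such that $\bar J\bar H$ is normal to $\bar M$. Assume that $\bar M$ has non-zero constant mean curvature $|\bar H|$. Then: (a) If $\bar M$ is proper-biharmonic, then $|\bar H|^2\in(0,1]$. (b) If $|\bar H|^2=1$, then $\bar M$ is proper-biharmonic if and only if it is pseudo-umbilical and $\nabla^\perp\bar H=0$.
   Context: $\mathbb{C}P^n$ carries the Fubini-Study metric $\langle\cdot,\cdot\rangle$ of constant holomorphic sectional curvature $4$; $\bar J$ is its complex structure. $\bar H=\frac{1}{\bar m}\operatorname{trace}\bar B$ is the mean curvature vector field of $\bar M$ (with $\bar B$ the second fundamental form), and $\nabla^\perp$ is the normal connection. $\bar M$ is pseudo-umbilical if the Weingarten operator satisfies $\bar A_{\bar H}=|\bar H|^2\,\mathrm{Id}$. A map $\varphi:(M,g)\to(N,h)$ is biharmonic if $\tau_2(\varphi)=-\Delta^{\varphi}\tau(\varphi)-\operatorname{trace}R^N(d\varphi,\tau(\varphi))d\varphi=0$, where $\tau(\varphi)=\operatorname{trace}\nabla d\varphi$, $\Delta^\varphi=-\operatorname{trace}(\nabla^\varphi)^2$ and $R^N(X,Y)Z=\nabla_X\nabla_YZ-\nabla_Y\nabla_XZ-\nabla_{[X,Y]}Z$; it is proper-biharmonic if moreover it is not harmonic ($\tau(\varphi)\not\equiv0$). A submanifold is (proper-)biharmonic if its inclusion map, with the induced metric, is so. *)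

theory Defs
  imports "HOL-Analysis.Analysis"
begin

section \<open>Smooth maps between open subsets of Euclidean spaces\<close>

abbreviation D :: "('a::real_normed_vector \<Rightarrow> 'b::real_normed_vector) \<Rightarrow> 'a \<Rightarrow> 'a \<Rightarrow> 'b" where
  "D f x \<equiv> frechet_derivative f (at x)"

primrec Ck_on :: "nat \<Rightarrow> 'a::real_normed_vector set \<Rightarrow> ('a \<Rightarrow> 'b::real_normed_vector) \<Rightarrow> bool" where
  "Ck_on 0 S f \<longleftrightarrow> continuous_on S f"
| "Ck_on (Suc k) S f \<longleftrightarrow>
     (\<forall>x\<in>S. f differentiable (at x)) \<and> (\<forall>v. Ck_on k S (\<lambda>x. D f x v))"

text \<open>Only meaningful for open \<open>S\<close>.\<close>

definition smooth_on :: "'a::real_normed_vector set \<Rightarrow> ('a \<Rightarrow> 'b::real_normed_vector) \<Rightarrow> bool" where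
  "smooth_on S f \<longleftrightarrow> (\<forall>k. Ck_on k S f)"


section \<open>Riemannian geometry in local coordinates\<close>

text \<open>
  Throughout this section \<open>g\<close> and \<open>h\<close> are Riemannian metrics on open subsets of the Euclidean
  spaces \<open>'a\<close> and \<open>'b\<close>, written as \<open>g x u v\<close> with \<open>x\<close> the point and \<open>u\<close>, \<open>v\<close> tangent vectors, and
  \<open>f\<close> is a smooth map from the first open set to the second. All notions are pointwise and depend
  only on the germs of \<open>g\<close>, \<open>h\<close>, \<open>f\<close> at (the image of) the point.
\<close>

type_synonym 'a tensor = "'a \<Rightarrow> 'a \<Rightarrow> 'a \<Rightarrow> real"

definition inner_product :: "('a::euclidean_space \<Rightarrow> 'a \<Rightarrow> real) \<Rightarrow> bool" where
  "inner_product q \<longleftrightarrow> bilinear q \<and> (\<forall>u v. q u v = q v u) \<and> (\<forall>u. u \<noteq> 0 \<longrightarrow> q u u > 0)"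

definition orthonormal_basis :: "('a::euclidean_space \<Rightarrow> 'a \<Rightarrow> real) \<Rightarrow> 'a set \<Rightarrow> bool" where
  "orthonormal_basis q E \<longleftrightarrow>
     card E = DIM('a) \<and> (\<forall>u\<in>E. \<forall>v\<in>E. q u v = (if u = v then 1 else 0))"

text \<open>The trace of a bilinear map does not depend on the orthonormal basis chosen.\<close>

definition metric_trace ::
  "('a::euclidean_space \<Rightarrow> 'a \<Rightarrow> real) \<Rightarrow> ('a \<Rightarrow> 'a \<Rightarrow> 'b::real_vector) \<Rightarrow> 'b" where
  "metric_trace q b = (\<Sum>e\<in>(SOME E. orthonormal_basis q E). b e e)"

text \<open>
  Koszul formula for coordinate vector fields: the Levi-Civita connection of \<open>g\<close> is
  \<open>(\<nabla>\<^sub>X Y)(x) = D Y x (X x) + christoffel g x (X x) (Y x)\<close>.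
\<close>

definition christoffel :: "'a::euclidean_space tensor \<Rightarrow> 'a \<Rightarrow> 'a \<Rightarrow> 'a \<Rightarrow> 'a" where
  "christoffel g x u v = (THE w. \<forall>z. g x w z =
     (D (\<lambda>y. g y v z) x u + D (\<lambda>y. g y u z) x v - D (\<lambda>y. g y u v) x z) / 2)"

definition levi_civita ::
  "'a::euclidean_space tensor \<Rightarrow> ('a \<Rightarrow> 'a) \<Rightarrow> ('a \<Rightarrow> 'a) \<Rightarrow> 'a \<Rightarrow> 'a" where
  "levi_civita g X Y x = D Y x (X x) + christoffel g x (X x) (Y x)"

definition lie_bracket ::
  "('a::euclidean_space \<Rightarrow> 'a) \<Rightarrow> ('a \<Rightarrow> 'a) \<Rightarrow> 'a \<Rightarrow> 'a" where
  "lie_bracket X Y x = D Y x (X x) - D X x (Y x)"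

definition curvature_field ::
  "'a::euclidean_space tensor \<Rightarrow> ('a \<Rightarrow> 'a) \<Rightarrow> ('a \<Rightarrow> 'a) \<Rightarrow> ('a \<Rightarrow> 'a) \<Rightarrow> 'a \<Rightarrow> 'a" where
  "curvature_field g X Y Z x =
     levi_civita g X (levi_civita g Y Z) x - levi_civita g Y (levi_civita g X Z) x
     - levi_civita g (lie_bracket X Y) Z x"

text \<open>The curvature is tensorial, so tangent vectors may be extended by constant fields.\<close>

definition curvature :: "'a::euclidean_space tensor \<Rightarrow> 'a \<Rightarrow> 'a \<Rightarrow> 'a \<Rightarrow> 'a \<Rightarrow> 'a" where
  "curvature g x u v w = curvature_field g (\<lambda>_. u) (\<lambda>_. v) (\<lambda>_. w) x"

subsection \<open>Harmonic and biharmonic maps\<close>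

text \<open>
  The connection of the pull-back bundle \<open>f\<^sup>*TN\<close>: the covariant derivative at \<open>x\<close>, in the
  direction \<open>u\<close>, of a section \<open>V\<close> (\<open>V y\<close> is a tangent vector at \<open>f y\<close>).
\<close>

definition pullback_conn ::
  "'b::euclidean_space tensor \<Rightarrow> ('a::euclidean_space \<Rightarrow> 'b) \<Rightarrow> ('a \<Rightarrow> 'b) \<Rightarrow> 'a \<Rightarrow> 'a \<Rightarrow> 'b" where
  "pullback_conn h f V x u = D V x u + christoffel h (f x) (D f x u) (V x)"

text \<open>
  In the next two definitions the vector \<open>v\<close> is extended to a constant field, whose Levi-Civita
  derivative in the direction \<open>u\<close> is \<open>christoffel g x u v\<close>.
\<close>

definition nabla_df ::
  "'a::euclidean_space tensor \<Rightarrow> 'b::euclidean_space tensor \<Rightarrow> ('a \<Rightarrow> 'b) \<Rightarrow> 'a \<Rightarrow> 'a \<Rightarrow> 'a \<Rightarrow> 'b" where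
  "nabla_df g h f x u v =
     pullback_conn h f (\<lambda>y. D f y v) x u - D f x (christoffel g x u v)"

definition second_cov_deriv ::
  "'a::euclidean_space tensor \<Rightarrow> 'b::euclidean_space tensor \<Rightarrow> ('a \<Rightarrow> 'b) \<Rightarrow> ('a \<Rightarrow> 'b)
    \<Rightarrow> 'a \<Rightarrow> 'a \<Rightarrow> 'a \<Rightarrow> 'b" where
  "second_cov_deriv g h f V x u v =
     pullback_conn h f (\<lambda>y. pullback_conn h f V y v) x u
     - pullback_conn h f V x (christoffel g x u v)"

definition tension ::
  "'a::euclidean_space tensor \<Rightarrow> 'b::euclidean_space tensor \<Rightarrow> ('a \<Rightarrow> 'b) \<Rightarrow> 'a \<Rightarrow> 'b" where
  "tension g h f x = metric_trace (g x) (nabla_df g h f x)"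

definition rough_laplacian ::
  "'a::euclidean_space tensor \<Rightarrow> 'b::euclidean_space tensor \<Rightarrow> ('a \<Rightarrow> 'b) \<Rightarrow> ('a \<Rightarrow> 'b) \<Rightarrow> 'a \<Rightarrow> 'b" where
  "rough_laplacian g h f V x = - metric_trace (g x) (second_cov_deriv g h f V x)"

definition bitension ::
  "'a::euclidean_space tensor \<Rightarrow> 'b::euclidean_space tensor \<Rightarrow> ('a \<Rightarrow> 'b) \<Rightarrow> 'a \<Rightarrow> 'b" where
  "bitension g h f x =
     - rough_laplacian g h f (tension g h f) x
     - metric_trace (g x)
         (\<lambda>u v. curvature h (f x) (D f x u) (tension g h f x) (D f x v))"

subsection \<open>Extrinsic geometry of isometric immersions\<close>

definition normal_vector ::
  "'b::euclidean_space tensor \<Rightarrow> ('a::euclidean_space \<Rightarrow> 'b) \<Rightarrow> 'a \<Rightarrow> 'b \<Rightarrow> bool" where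
  "normal_vector h f x w \<longleftrightarrow> (\<forall>u. h (f x) w (D f x u) = 0)"

text \<open>
  \<open>w = D f x (tangent_part h f x w) + normal_part h f x w\<close> is the decomposition of \<open>w\<close> along the
  immersion \<open>f\<close>; the tangential part is expressed in the coordinates of the source.
\<close>

definition tangent_part ::
  "'b::euclidean_space tensor \<Rightarrow> ('a::euclidean_space \<Rightarrow> 'b) \<Rightarrow> 'a \<Rightarrow> 'b \<Rightarrow> 'a" where
  "tangent_part h f x w = (THE u. normal_vector h f x (w - D f x u))"

definition normal_part ::
  "'b::euclidean_space tensor \<Rightarrow> ('a::euclidean_space \<Rightarrow> 'b) \<Rightarrow> 'a \<Rightarrow> 'b \<Rightarrow> 'b" where
  "normal_part h f x w = w - D f x (tangent_part h f x w)"

text \<open>Gauss formula: \<open>B(X,Y)\<close> is the normal part of the ambient derivative \<open>\<nabla>\<^sub>X Y\<close>.\<close>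

definition second_fundamental_form ::
  "'b::euclidean_space tensor \<Rightarrow> ('a::euclidean_space \<Rightarrow> 'b) \<Rightarrow> 'a \<Rightarrow> 'a \<Rightarrow> 'a \<Rightarrow> 'b" where
  "second_fundamental_form h f x u v =
     normal_part h f x (pullback_conn h f (\<lambda>y. D f y v) x u)"

definition mean_curvature ::
  "'a::euclidean_space tensor \<Rightarrow> 'b::euclidean_space tensor \<Rightarrow> ('a \<Rightarrow> 'b) \<Rightarrow> 'a \<Rightarrow> 'b" where
  "mean_curvature g h f x =
     (1 / real DIM('a)) *\<^sub>R metric_trace (g x) (second_fundamental_form h f x)"

definition mean_curvature_norm ::
  "'a::euclidean_space tensor \<Rightarrow> 'b::euclidean_space tensor \<Rightarrow> ('a \<Rightarrow> 'b) \<Rightarrow> 'a \<Rightarrow> real" where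
  "mean_curvature_norm g h f x =
     sqrt (h (f x) (mean_curvature g h f x) (mean_curvature g h f x))"

text \<open>Weingarten formula, for a normal field \<open>\<xi>\<close>: \<open>\<nabla>\<^sub>X \<xi> = - A\<^sub>\<xi> X + \<nabla>\<^sup>\<bottom>\<^sub>X \<xi>\<close>.\<close>

definition weingarten ::
  "'b::euclidean_space tensor \<Rightarrow> ('a::euclidean_space \<Rightarrow> 'b) \<Rightarrow> ('a \<Rightarrow> 'b) \<Rightarrow> 'a \<Rightarrow> 'a \<Rightarrow> 'a" where
  "weingarten h f \<xi> x u = - tangent_part h f x (pullback_conn h f \<xi> x u)"

definition normal_conn ::
  "'b::euclidean_space tensor \<Rightarrow> ('a::euclidean_space \<Rightarrow> 'b) \<Rightarrow> ('a \<Rightarrow> 'b) \<Rightarrow> 'a \<Rightarrow> 'a \<Rightarrow> 'b" where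
  "normal_conn h f \<xi> x u = normal_part h f x (pullback_conn h f \<xi> x u)"


section \<open>Riemannian manifolds\<close>

text \<open>
  A manifold is given by its charts, each of them consisting of an open set of coordinates, a
  parametrization of a subset of the manifold by these coordinates, and the Riemannian metric
  expressed in these coordinates.
\<close>

record ('a, 'p) chart =
  chart_dom :: "'a set"
  chart_par :: "'a \<Rightarrow> 'p"
  chart_met :: "'a tensor"

type_synonym ('a, 'p) manifold = "('a, 'p) chart set"

definition points :: "('a::euclidean_space, 'p) manifold \<Rightarrow> 'p set" where
  "points M = (\<Union>c\<in>M. chart_par c ` chart_dom c)"

definition coord_dom ::
  "('a::euclidean_space, 'p) chart \<Rightarrow> ('b::euclidean_space, 'q) chart \<Rightarrow> ('p \<Rightarrow> 'q) \<Rightarrow> 'a set" where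
  "coord_dom c d \<phi> = {x \<in> chart_dom c. \<phi> (chart_par c x) \<in> chart_par d ` chart_dom d}"

definition coord_rep ::
  "('a::euclidean_space, 'p) chart \<Rightarrow> ('b::euclidean_space, 'q) chart \<Rightarrow> ('p \<Rightarrow> 'q) \<Rightarrow> 'a \<Rightarrow> 'b" where
  "coord_rep c d \<phi> x = inv_into (chart_dom d) (chart_par d) (\<phi> (chart_par c x))"

text \<open>
  \<open>P\<close> holds, at all points of \<open>M\<close>, for the two metrics and the map \<open>\<phi>\<close> expressed in any pair of
  charts around the point and its image.
\<close>

definition in_charts ::
  "('a::euclidean_space, 'p) manifold \<Rightarrow> ('b::euclidean_space, 'q) manifold \<Rightarrow> ('p \<Rightarrow> 'q)
    \<Rightarrow> ('a tensor \<Rightarrow> 'b tensor \<Rightarrow> ('a \<Rightarrow> 'b) \<Rightarrow> 'a \<Rightarrow> bool) \<Rightarrow> bool" where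
  "in_charts M N \<phi> P \<longleftrightarrow>
     (\<forall>c\<in>M. \<forall>d\<in>N. \<forall>x\<in>coord_dom c d \<phi>. P (chart_met c) (chart_met d) (coord_rep c d \<phi>) x)"

definition smooth_map ::
  "('a::euclidean_space, 'p) manifold \<Rightarrow> ('b::euclidean_space, 'q) manifold \<Rightarrow> ('p \<Rightarrow> 'q) \<Rightarrow> bool" where
  "smooth_map M N \<phi> \<longleftrightarrow> \<phi> ` points M \<subseteq> points N \<and>
     (\<forall>c\<in>M. \<forall>d\<in>N. open (coord_dom c d \<phi>) \<and> smooth_on (coord_dom c d \<phi>) (coord_rep c d \<phi>))"

definition isometric ::
  "('a::euclidean_space, 'p) manifold \<Rightarrow> ('b::euclidean_space, 'q) manifold \<Rightarrow> ('p \<Rightarrow> 'q) \<Rightarrow> bool" where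
  "isometric M N \<phi> \<longleftrightarrow>
     in_charts M N \<phi> (\<lambda>g h f x. \<forall>u v. g x u v = h (f x) (D f x u) (D f x v))"

definition manifold_open :: "('a::euclidean_space, 'p) manifold \<Rightarrow> 'p set \<Rightarrow> bool" where
  "manifold_open M S \<longleftrightarrow>
     S \<subseteq> points M \<and> (\<forall>c\<in>M. open {x \<in> chart_dom c. chart_par c x \<in> S})"

text \<open>
  The condition on \<open>id\<close> expresses that the coordinate changes are smooth with open domains, and
  that the coordinate expressions of the metric match; the last two conditions are the Hausdorff
  property and second countability.
\<close>

definition riemannian_manifold :: "('a::euclidean_space, 'p) manifold \<Rightarrow> bool" where
  "riemannian_manifold M \<longleftrightarrow>
     (\<forall>c\<in>M. open (chart_dom c) \<and> inj_on (chart_par c) (chart_dom c)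
        \<and> (\<forall>x\<in>chart_dom c. inner_product (chart_met c x))
        \<and> (\<forall>u v. smooth_on (chart_dom c) (\<lambda>x. chart_met c x u v)))
     \<and> smooth_map M M id \<and> isometric M M id
     \<and> (\<forall>p\<in>points M. \<forall>q\<in>points M. p \<noteq> q \<longrightarrow>
          (\<exists>S T. manifold_open M S \<and> manifold_open M T \<and> p \<in> S \<and> q \<in> T \<and> S \<inter> T = {}))
     \<and> (\<exists>C\<subseteq>M. countable C \<and> points C = points M)"

text \<open>
  An (immersed) submanifold with the induced metric. As metrics are positive definite, the
  differential of an isometric map is injective.
\<close>

definition riemannian_submanifold ::
  "('a::euclidean_space, 'p) manifold \<Rightarrow> ('b::euclidean_space, 'p) manifold \<Rightarrow> bool" where
  "riemannian_submanifold M N \<longleftrightarrow>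
     riemannian_manifold M \<and> points M \<subseteq> points N \<and> smooth_map M N id \<and> isometric M N id"

definition harmonic_map ::
  "('a::euclidean_space, 'p) manifold \<Rightarrow> ('b::euclidean_space, 'q) manifold \<Rightarrow> ('p \<Rightarrow> 'q) \<Rightarrow> bool" where
  "harmonic_map M N \<phi> \<longleftrightarrow> in_charts M N \<phi> (\<lambda>g h f x. tension g h f x = 0)"

definition biharmonic_map ::
  "('a::euclidean_space, 'p) manifold \<Rightarrow> ('b::euclidean_space, 'q) manifold \<Rightarrow> ('p \<Rightarrow> 'q) \<Rightarrow> bool" where
  "biharmonic_map M N \<phi> \<longleftrightarrow> in_charts M N \<phi> (\<lambda>g h f x. bitension g h f x = 0)"

definition proper_biharmonic_map ::
  "('a::euclidean_space, 'p) manifold \<Rightarrow> ('b::euclidean_space, 'q) manifold \<Rightarrow> ('p \<Rightarrow> 'q) \<Rightarrow> bool" where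
  "proper_biharmonic_map M N \<phi> \<longleftrightarrow> biharmonic_map M N \<phi> \<and> \<not> harmonic_map M N \<phi>"

definition proper_biharmonic_submanifold ::
  "('a::euclidean_space, 'p) manifold \<Rightarrow> ('b::euclidean_space, 'p) manifold \<Rightarrow> bool" where
  "proper_biharmonic_submanifold M N \<longleftrightarrow> proper_biharmonic_map M N id"

definition constant_mean_curvature ::
  "('a::euclidean_space, 'p) manifold \<Rightarrow> ('b::euclidean_space, 'p) manifold \<Rightarrow> real \<Rightarrow> bool" where
  "constant_mean_curvature M N c \<longleftrightarrow>
     in_charts M N id (\<lambda>g h f x. mean_curvature_norm g h f x = c)"

definition pseudo_umbilical ::
  "('a::euclidean_space, 'p) manifold \<Rightarrow> ('b::euclidean_space, 'p) manifold \<Rightarrow> bool" where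
  "pseudo_umbilical M N \<longleftrightarrow> in_charts M N id (\<lambda>g h f x. \<forall>u.
     weingarten h f (mean_curvature g h f) x u = (mean_curvature_norm g h f x)\<^sup>2 *\<^sub>R u)"

definition parallel_mean_curvature ::
  "('a::euclidean_space, 'p) manifold \<Rightarrow> ('b::euclidean_space, 'p) manifold \<Rightarrow> bool" where
  "parallel_mean_curvature M N \<longleftrightarrow> in_charts M N id (\<lambda>g h f x. \<forall>u.
     normal_conn h f (mean_curvature g h f) x u = 0)"


section \<open>Complex projective space\<close>

text \<open>
  The homogeneous coordinates are indexed by \<open>'n option\<close>, which has \<open>CARD('n) + 1\<close> elements; the
  points are the complex lines through the origin.
\<close>

type_synonym 'n hom_coords = "complex ^ ('n option)"

definition complex_line :: "'n::finite hom_coords \<Rightarrow> 'n hom_coords set" where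
  "complex_line Z = range (\<lambda>a. a *s Z)"

definition hermitian :: "'n::finite hom_coords \<Rightarrow> 'n hom_coords \<Rightarrow> complex" where
  "hermitian Z W = (\<Sum>i\<in>UNIV. Z $ i * cnj (W $ i))"

text \<open>
  The Fubini-Study metric, pulled back to the nonzero vectors \<open>Z\<close> of homogeneous coordinates. It
  is normalized so that the unit sphere projects onto complex projective space by a Riemannian
  submersion, which yields constant holomorphic sectional curvature 4.
\<close>

definition fubini_study :: "'n::finite hom_coords tensor" where
  "fubini_study Z U V = Re (hermitian U V / hermitian Z Z
     - hermitian U Z * hermitian Z V / (hermitian Z Z)\<^sup>2)"

text \<open>
  Homogeneous coordinates of the point with affine coordinates \<open>z\<close> in the chart \<open>{Z\<^sub>i \<noteq> 0}\<close>: the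
  \<open>i\<close>-th one is \<open>1\<close>. If \<open>i = Some l\<close>, the component \<open>z $ l\<close> is stored at position \<open>None\<close>.
\<close>

definition affine_lift :: "'n::finite option \<Rightarrow> complex ^ 'n \<Rightarrow> 'n hom_coords" where
  "affine_lift i z = (\<chi> j. if j = i then 1
     else (case j of Some k \<Rightarrow> z $ k | None \<Rightarrow> z $ the i))"

definition affine_chart ::
  "'n::finite option \<Rightarrow> (complex ^ 'n, 'n hom_coords set) chart" where
  "affine_chart i =
     \<lparr> chart_dom = UNIV,
       chart_par = (\<lambda>z. complex_line (affine_lift i z)),
       chart_met = (\<lambda>z u v. fubini_study (affine_lift i z)
                      (D (affine_lift i) z u) (D (affine_lift i) z v)) \<rparr>"

definition complex_projective_space ::
  "(complex ^ 'n::finite, 'n hom_coords set) manifold" where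
  "complex_projective_space = range affine_chart"

text \<open>
  The affine charts are holomorphic charts, so in each of them the complex structure of complex
  projective space is the multiplication by \<open>\<i>\<close>.
\<close>

definition complex_structure :: "complex ^ 'n::finite \<Rightarrow> complex ^ 'n" where
  "complex_structure v = \<i> *s v"

definition J_mean_curvature_normal ::
  "('a::euclidean_space, 'n::finite hom_coords set) manifold \<Rightarrow> bool" where
  "J_mean_curvature_normal M \<longleftrightarrow>
     in_charts M complex_projective_space id
       (\<lambda>g h f x. normal_vector h f x (complex_structure (mean_curvature g h f x)))"

end

theory Submission
  imports Defs
begin

text \<open>
  Write \<open>m\<close> for the dimension of the submanifold, \<open>H\<close> for its mean curvature vector, \<open>\<nabla>\<close> for the
  connection of the ambient space along it and \<open>A\<close> for the Weingarten operator of \<open>H\<close>. The tension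
  of the inclusion is \<open>m H\<close>. The Jacobi operator \<open>v \<mapsto> R(u,v)u\<close> of the Fubini-Study metric is
  \<open>\<langle>u,v\<rangle>u - \<langle>u,u\<rangle>v + 3\<langle>u,Jv\<rangle>Ju\<close>; as \<open>H\<close> and \<open>JH\<close> are normal, the curvature term of the
  bitension is a multiple of \<open>H\<close>, and
    \<open>\<tau>\<^sub>2 = m (trace \<nabla>\<^sup>2 H + m H)\<close>
  (lemma \<open>bitension_eq\<close>).

  Suppose that \<open>\<tau>\<^sub>2 = 0\<close> and that \<open>\<langle>H,H\<rangle> = r\<close> is constant. Differentiating \<open>\<langle>H,H\<rangle>\<close> twice gives
  \<open>\<langle>trace \<nabla>\<^sup>2 H, H\<rangle> = - |\<nabla>H|\<^sup>2\<close>, hence \<open>|\<nabla>H|\<^sup>2 = m r\<close>. By the Weingarten formula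
  \<open>|\<nabla>H|\<^sup>2 = |A|\<^sup>2 + |\<nabla>\<^sup>\<bottom>H|\<^sup>2\<close>. The trace of \<open>A\<close> is \<open>m r\<close>, so that \<open>|A - r Id|\<^sup>2 = |A|\<^sup>2 - m r\<^sup>2\<close>,
  and altogether
    \<open>m r (1 - r) = |A - r Id|\<^sup>2 + |\<nabla>\<^sup>\<bottom>H|\<^sup>2\<close>
  (lemma \<open>biharmonic_identity\<close>). The right-hand side is nonnegative, whence \<open>r \<le> 1\<close>; if \<open>r = 1\<close>, it
  vanishes, which says that \<open>A = Id\<close> and \<open>\<nabla>\<^sup>\<bottom>H = 0\<close>. Conversely, if \<open>A = Id\<close> and \<open>\<nabla>\<^sup>\<bottom>H = 0\<close>, then
  \<open>\<nabla>\<^sub>u H = - df(u)\<close>, so \<open>\<nabla>\<^sup>2 H\<close> is the negative of the second fundamental form, its trace is \<open>- m H\<close>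
  and the bitension vanishes.

  The computation takes place in one chart of the submanifold and one affine chart of the
  projective space, where metric, connection and curvature are explicit rational expressions. What
  remains to be supplied is the regularity that allows differentiating \<open>H\<close> twice, although \<open>H\<close> is
  defined by orthonormal bases chosen independently at each point: the trace is rewritten by means
  of the dual basis of the coordinate basis, which is smooth by Cramer's rule.
\<close>

section \<open>Calculus of smooth maps\<close>

lemma D_eqI: "(f has_derivative f') (at x) \<Longrightarrow> D f x = f'"
  by (rule frechet_derivative_at[symmetric])

lemma Ck_on_cong:
  assumes "open S" "\<And>x. x \<in> S \<Longrightarrow> f x = g x"
  shows "Ck_on k S f \<longleftrightarrow> Ck_on k S g"
  using assms(2)
proof (induction k arbitrary: f g)
  case 0
  then show ?case by (simp cong: continuous_on_cong)
next
  case (Suc k)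
  have diff: "f differentiable (at x) \<longleftrightarrow> g differentiable (at x)" if "x \<in> S" for x
    unfolding differentiable_def
    using has_derivative_transform_within_open[of f _ x UNIV S g]
      has_derivative_transform_within_open[of g _ x UNIV S f] that assms(1) Suc.prems
    by auto
  show ?case
  proof (cases "\<forall>x\<in>S. f differentiable (at x)")
    case True
    have "D f x v = D g x v" if "x \<in> S" for x v
      using frechet_derivative_transform_within_open[OF _ assms(1) that, of f g] that True Suc.prems
      by simp
    then have "Ck_on k S (\<lambda>x. D f x v) \<longleftrightarrow> Ck_on k S (\<lambda>x. D g x v)" for v
      by (rule Suc.IH)
    then show ?thesis using diff by simp
  next
    case False
    then show ?thesis using diff by auto
  qed
qed

lemma Ck_on_transform:
  "open S \<Longrightarrow> Ck_on k S g \<Longrightarrow> (\<And>x. x \<in> S \<Longrightarrow> f x = g x) \<Longrightarrow> Ck_on k S f"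
  using Ck_on_cong by blast

lemma Ck_on_SucD: "Ck_on (Suc k) S f \<Longrightarrow> Ck_on k S f"
proof (induction k arbitrary: f)
  case 0
  then have "f differentiable_on S"
    unfolding differentiable_on_def by (simp add: differentiable_at_withinI)
  then show ?case by (simp add: differentiable_imp_continuous_on)
next
  case (Suc k)
  note * = Ck_on.simps(2)[THEN iffD1, OF Suc.prems]
  show ?case
    by (rule Ck_on.simps(2)[THEN iffD2], rule conjI, rule conjunct1[OF *], rule allI, rule Suc.IH,
        rule spec[OF conjunct2[OF *]])
qed

lemma Ck_on_const: "Ck_on k S (\<lambda>x. c)"
  by (induction k arbitrary: c) auto

lemma Ck_on_add:
  assumes "open S" "Ck_on k S f" "Ck_on k S g"
  shows "Ck_on k S (\<lambda>x. f x + g x)"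
  using assms(2,3)
proof (induction k arbitrary: f g)
  case 0
  then show ?case by (auto intro: continuous_intros)
next
  case (Suc k)
  have "D (\<lambda>x. f x + g x) x v = D f x v + D g x v" if "x \<in> S" for x v
  proof -
    have "((\<lambda>x. f x + g x) has_derivative (\<lambda>v. D f x v + D g x v)) (at x)"
      using Suc.prems that by (intro has_derivative_add) (auto simp: frechet_derivative_works)
    then show ?thesis by (simp add: D_eqI)
  qed
  moreover have "Ck_on k S (\<lambda>x. D f x v + D g x v)" for v
    by (rule Suc.IH) (use Suc.prems in simp_all)
  ultimately have "Ck_on k S (\<lambda>x. D (\<lambda>x. f x + g x) x v)" for v
    by (rule Ck_on_transform[OF assms(1), rotated])
  then show ?case using Suc.prems by (auto intro: differentiable_add)
qed

text \<open>
  The two terms of the product rule are again products of the same kind, one factor losing a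
  derivative; since the other factor keeps all of its derivatives, the induction needs that
  \<open>C\<^sup>k\<^sup>+\<^sup>1\<close> implies \<open>C\<^sup>k\<close>. The following inversion is handled in the same way, because
  \<open>D (1/f) = - Df / f\<^sup>2\<close>.
\<close>

lemma Ck_on_bilinear:
  fixes p :: "'b::real_normed_vector \<Rightarrow> 'c::real_normed_vector \<Rightarrow> 'd::real_normed_vector"
  assumes p: "bounded_bilinear p" and S: "open S" and "Ck_on k S f" "Ck_on k S g"
  shows "Ck_on k S (\<lambda>x. p (f x) (g x))"
  using assms(3,4)
proof (induction k arbitrary: f g)
  case 0
  then show ?case by (auto intro: bounded_bilinear.continuous_on[OF p])
next
  case (Suc k)
  have deriv: "((\<lambda>x. p (f x) (g x)) has_derivative (\<lambda>v. p (f x) (D g x v) + p (D f x v) (g x))) (at x)"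
    if "x \<in> S" for x
    using Suc.prems that
    by (intro bounded_bilinear.FDERIV[OF p]) (auto simp: frechet_derivative_works)
  then have "D (\<lambda>x. p (f x) (g x)) x v = p (f x) (D g x v) + p (D f x v) (g x)" if "x \<in> S" for x v
    using D_eqI[OF deriv[OF that]] by simp
  moreover have "Ck_on k S (\<lambda>x. p (f x) (D g x v) + p (D f x v) (g x))" for v
    using Suc.prems Ck_on_SucD[OF Suc.prems(1)] Ck_on_SucD[OF Suc.prems(2)]
    by (intro Ck_on_add[OF S] Suc.IH) auto
  ultimately have "Ck_on k S (\<lambda>x. D (\<lambda>x. p (f x) (g x)) x v)" for v
    by (rule Ck_on_transform[OF S, rotated])
  then show ?case using deriv by (auto simp: differentiable_def)
qed

lemma Ck_on_inverse:
  fixes f :: "'a::real_normed_vector \<Rightarrow> real"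
  assumes S: "open S" and "Ck_on k S f" and nz: "\<And>x. x \<in> S \<Longrightarrow> f x \<noteq> 0"
  shows "Ck_on k S (\<lambda>x. inverse (f x))"
  using assms(2)
proof (induction k)
  case 0
  then show ?case using nz by (auto intro: continuous_on_inverse)
next
  case (Suc k)
  have deriv: "((\<lambda>x. inverse (f x)) has_derivative
      (\<lambda>v. - (inverse (f x) * D f x v * inverse (f x)))) (at x)" if "x \<in> S" for x
    using Suc.prems that nz
    by (intro Deriv.has_derivative_inverse) (auto simp: frechet_derivative_works)
  then have "D (\<lambda>x. inverse (f x)) x v = (- 1) * (inverse (f x) * D f x v * inverse (f x))"
    if "x \<in> S" for x v
    by (simp add: D_eqI[OF deriv[OF that]])
  moreover have "Ck_on k S (\<lambda>x. (- 1) * (inverse (f x) * D f x v * inverse (f x)))" for v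
    using Suc.prems Suc.IH[OF Ck_on_SucD[OF Suc.prems]]
    by (intro Ck_on_bilinear[OF bounded_bilinear_mult S] Ck_on_const) auto
  ultimately have "Ck_on k S (\<lambda>x. D (\<lambda>x. inverse (f x)) x v)" for v
    by (rule Ck_on_transform[OF S, rotated])
  then show ?case using deriv by (auto simp: differentiable_def)
qed

lemma smooth_on_cong:
  "open S \<Longrightarrow> (\<And>x. x \<in> S \<Longrightarrow> f x = g x) \<Longrightarrow> smooth_on S f \<longleftrightarrow> smooth_on S g"
  unfolding smooth_on_def using Ck_on_cong by blast

lemma smooth_on_transform:
  "open S \<Longrightarrow> smooth_on S g \<Longrightarrow> (\<And>x. x \<in> S \<Longrightarrow> f x = g x) \<Longrightarrow> smooth_on S f"
  using smooth_on_cong by blast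

lemma smooth_on_subset:
  assumes "smooth_on S f" "T \<subseteq> S"
  shows "smooth_on T f"
proof -
  have "Ck_on k T f" if "Ck_on k S f" for k f
    using that assms(2)
    by (induction k arbitrary: f) (auto intro: continuous_on_subset)
  then show ?thesis using assms by (auto simp: smooth_on_def)
qed

lemma smooth_on_const: "smooth_on S (\<lambda>x. c)"
  by (simp add: smooth_on_def Ck_on_const)

lemma smooth_on_differentiable: "smooth_on S f \<Longrightarrow> x \<in> S \<Longrightarrow> f differentiable (at x)"
  unfolding smooth_on_def using Ck_on.simps(2)[of 0 S f] by blast

lemma smooth_on_has_derivative: "smooth_on S f \<Longrightarrow> x \<in> S \<Longrightarrow> (f has_derivative D f x) (at x)"
  using smooth_on_differentiable frechet_derivative_works by blast

lemma smooth_on_continuous: "smooth_on S f \<Longrightarrow> continuous_on S f"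
  unfolding smooth_on_def using Ck_on.simps(1)[of S f] by blast

lemma smooth_on_D: "smooth_on S f \<Longrightarrow> smooth_on S (\<lambda>x. D f x v)"
  unfolding smooth_on_def by (intro allI) (use Ck_on.simps(2)[of _ S f] in blast)

lemma smooth_on_add:
  "open S \<Longrightarrow> smooth_on S f \<Longrightarrow> smooth_on S g \<Longrightarrow> smooth_on S (\<lambda>x. f x + g x)"
  by (simp add: smooth_on_def Ck_on_add)

lemma smooth_on_bilinear:
  "bounded_bilinear p \<Longrightarrow> open S \<Longrightarrow> smooth_on S f \<Longrightarrow> smooth_on S g \<Longrightarrow>
    smooth_on S (\<lambda>x. p (f x) (g x))"
  by (simp add: smooth_on_def Ck_on_bilinear)

lemma smooth_on_inverse:
  fixes f :: "'a::real_normed_vector \<Rightarrow> real"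
  shows "open S \<Longrightarrow> smooth_on S f \<Longrightarrow> (\<And>x. x \<in> S \<Longrightarrow> f x \<noteq> 0) \<Longrightarrow>
    smooth_on S (\<lambda>x. inverse (f x))"
  by (simp add: smooth_on_def Ck_on_inverse)

lemmas smooth_on_scaleR = smooth_on_bilinear[OF bounded_bilinear_scaleR]
  and smooth_on_mult = smooth_on_bilinear[OF bounded_bilinear_mult]
  and smooth_on_inner = smooth_on_bilinear[OF bounded_bilinear_inner]

lemma smooth_on_linear:
  assumes "bounded_linear p" "open S" "smooth_on S f"
  shows "smooth_on S (\<lambda>x. p (f x))"
proof -
  have "bounded_bilinear (\<lambda>(a::real) y. a *\<^sub>R p y)"
    by (rule bounded_bilinear.comp[OF bounded_bilinear_scaleR bounded_linear_ident assms(1)])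
  from smooth_on_bilinear[OF this assms(2) smooth_on_const[of _ 1] assms(3)] show ?thesis by simp
qed

lemma smooth_on_minus: "open S \<Longrightarrow> smooth_on S f \<Longrightarrow> smooth_on S (\<lambda>x. - f x)"
  using smooth_on_linear[OF bounded_linear_minus[OF bounded_linear_ident]] .

lemma smooth_on_diff:
  "open S \<Longrightarrow> smooth_on S f \<Longrightarrow> smooth_on S g \<Longrightarrow> smooth_on S (\<lambda>x. f x - g x)"
  using smooth_on_add[of S f "\<lambda>x. - g x"] smooth_on_minus[of S g] by simp

lemma smooth_on_divide:
  fixes f g :: "'a::real_normed_vector \<Rightarrow> real"
  shows "open S \<Longrightarrow> smooth_on S f \<Longrightarrow> smooth_on S g \<Longrightarrow> (\<And>x. x \<in> S \<Longrightarrow> g x \<noteq> 0) \<Longrightarrow>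
    smooth_on S (\<lambda>x. f x / g x)"
  unfolding divide_inverse by (intro smooth_on_mult smooth_on_inverse)

lemma smooth_on_sum:
  "open S \<Longrightarrow> (\<And>i. i \<in> I \<Longrightarrow> smooth_on S (f i)) \<Longrightarrow> smooth_on S (\<lambda>x. \<Sum>i\<in>I. f i x)"
  by (induction I rule: infinite_finite_induct) (auto intro: smooth_on_const smooth_on_add)

lemma smooth_on_prod:
  fixes f :: "'i \<Rightarrow> 'a::real_normed_vector \<Rightarrow> real"
  shows "open S \<Longrightarrow> (\<And>i. i \<in> I \<Longrightarrow> smooth_on S (f i)) \<Longrightarrow> smooth_on S (\<lambda>x. \<Prod>i\<in>I. f i x)"
  by (induction I rule: infinite_finite_induct) (auto intro: smooth_on_const smooth_on_mult)

lemma smooth_on_det: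
  fixes A :: "'a::real_normed_vector \<Rightarrow> real ^ 'n ^ 'n"
  assumes "open S" "\<And>i j. smooth_on S (\<lambda>x. A x $ i $ j)"
  shows "smooth_on S (\<lambda>x. det (A x))"
  unfolding det_def
  by (intro smooth_on_sum smooth_on_mult smooth_on_prod smooth_on_const assms)

section \<open>Symmetry of second derivatives\<close>

lemma has_derivative_along_line:
  assumes "(\<phi> has_derivative \<phi>') (at (x + t *\<^sub>R v))"
  shows "((\<lambda>t. \<phi> (x + t *\<^sub>R v)) has_derivative (\<lambda>s. s *\<^sub>R \<phi>' v)) (at t)"
proof -
  have "((\<lambda>t. x + t *\<^sub>R v) has_derivative (\<lambda>s. s *\<^sub>R v)) (at t)"
    by (auto intro!: derivative_eq_intros)
  from has_derivative_compose[OF this assms] show ?thesis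
    by (simp add: linear_scale[OF has_derivative_linear[OF assms]])
qed

text \<open>
  The mean value theorem applied twice, first in the direction \<open>v\<close> and then in the direction \<open>u\<close>.
  The second difference on the left is symmetric in \<open>u\<close> and \<open>v\<close>, so exchanging the two directions
  expresses it by the other mixed derivative; this is the source of Schwarz's theorem below.
\<close>

lemma second_difference_mvt:
  fixes \<phi> :: "'a::real_normed_vector \<Rightarrow> real"
  assumes U: "ball x r \<subseteq> U" and \<phi>: "\<And>y. y \<in> U \<Longrightarrow> \<phi> differentiable (at y)"
    and \<phi>': "\<And>y. y \<in> U \<Longrightarrow> (\<lambda>y. D \<phi> y v) differentiable (at y)"
    and h: "h > 0" "h * (norm u + norm v) < r"
  shows "\<exists>y. dist x y \<le> h * (norm u + norm v) \<and>
    \<phi> (x + h *\<^sub>R u + h *\<^sub>R v) - \<phi> (x + h *\<^sub>R u) - \<phi> (x + h *\<^sub>R v) + \<phi> x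
      = h * h * D (\<lambda>y. D \<phi> y v) y u"
proof -
  have dist: "dist x (x + s *\<^sub>R u + t *\<^sub>R v) \<le> h * (norm u + norm v)"
    if "0 \<le> s" "s \<le> h" "0 \<le> t" "t \<le> h" for s t
  proof -
    have "dist x (x + s *\<^sub>R u + t *\<^sub>R v) = norm (s *\<^sub>R u + t *\<^sub>R v)"
      by (metis add.assoc add_diff_cancel_left' dist_norm norm_minus_commute)
    also have "\<dots> \<le> s * norm u + t * norm v"
      using that norm_triangle_ineq[of "s *\<^sub>R u" "t *\<^sub>R v"] by simp
    also have "\<dots> \<le> h * norm u + h * norm v"
      using that by (intro add_mono mult_right_mono) auto
    finally show ?thesis by (simp add: distrib_left)
  qed
  then have inU: "x + s *\<^sub>R u + t *\<^sub>R v \<in> U" if "0 \<le> s" "s \<le> h" "0 \<le> t" "t \<le> h" for s t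
    using U h(2) that by (meson le_less_trans mem_ball subsetD)
  define G where "G t = \<phi> (x + h *\<^sub>R u + t *\<^sub>R v) - \<phi> (x + t *\<^sub>R v)" for t
  have G: "(G has_real_derivative D \<phi> (x + h *\<^sub>R u + t *\<^sub>R v) v - D \<phi> (x + t *\<^sub>R v) v) (at t)"
    if "0 \<le> t" "t \<le> h" for t
  proof -
    have "(\<phi> has_derivative D \<phi> (x + h *\<^sub>R u + t *\<^sub>R v)) (at (x + h *\<^sub>R u + t *\<^sub>R v))"
      and "(\<phi> has_derivative D \<phi> (x + t *\<^sub>R v)) (at (x + t *\<^sub>R v))"
      using \<phi> inU[of h t] inU[of 0 t] that h frechet_derivative_works by auto
    from has_derivative_diff[OF this[THEN has_derivative_along_line]] show ?thesis
      unfolding G_def has_field_derivative_def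
      by (rule has_derivative_eq_rhs) (auto simp: algebra_simps)
  qed
  from MVT2[OF h(1) G] obtain t where t: "0 < t" "t < h"
    "G h - G 0 = h * (D \<phi> (x + h *\<^sub>R u + t *\<^sub>R v) v - D \<phi> (x + t *\<^sub>R v) v)"
    by auto
  define K where "K s = D \<phi> (x + t *\<^sub>R v + s *\<^sub>R u) v" for s
  have swap: "x + t *\<^sub>R v + s *\<^sub>R u = x + s *\<^sub>R u + t *\<^sub>R v" for s
    by simp
  have K: "(K has_real_derivative D (\<lambda>y. D \<phi> y v) (x + t *\<^sub>R v + s *\<^sub>R u) u) (at s)"
    if "0 \<le> s" "s \<le> h" for s
  proof -
    have "((\<lambda>y. D \<phi> y v) has_derivative D (\<lambda>y. D \<phi> y v) (x + t *\<^sub>R v + s *\<^sub>R u))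
        (at (x + t *\<^sub>R v + s *\<^sub>R u))"
      unfolding swap using \<phi>' inU[of s t] that t by (auto simp flip: frechet_derivative_works)
    from has_derivative_along_line[OF this] show ?thesis
      unfolding K_def has_field_derivative_def
      by (rule has_derivative_eq_rhs) (auto simp: algebra_simps)
  qed
  from MVT2[OF h(1) K] obtain s where s: "0 < s" "s < h"
    "K h - K 0 = h * D (\<lambda>y. D \<phi> y v) (x + t *\<^sub>R v + s *\<^sub>R u) u"
    by auto
  have "\<phi> (x + h *\<^sub>R u + h *\<^sub>R v) - \<phi> (x + h *\<^sub>R u) - \<phi> (x + h *\<^sub>R v) + \<phi> x = G h - G 0"
    by (simp add: G_def)
  also have "\<dots> = h * (K h - K 0)"
    by (simp add: t(3) K_def swap)
  finally show ?thesis
    using s dist[of s t] t(1,2) by (intro exI[of _ "x + s *\<^sub>R u + t *\<^sub>R v"]) (auto simp: swap)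
qed

text \<open>
  If the mixed derivatives differed at \<open>x\<close>, then by continuity they would differ at all pairs of
  points near \<open>x\<close>, in particular at the two intermediate points which
  \<open>second_difference_mvt\<close> yields for the same small second difference.
\<close>

lemma D_D_commute_real:
  fixes \<phi> :: "'a::real_normed_vector \<Rightarrow> real"
  assumes U: "open U" "x \<in> U" and \<phi>: "smooth_on U \<phi>"
  shows "D (\<lambda>y. D \<phi> y v) x u = D (\<lambda>y. D \<phi> y u) x v"
proof (rule ccontr)
  let ?p = "\<lambda>y. D (\<lambda>y. D \<phi> y v) y u" and ?q = "\<lambda>y. D (\<lambda>y. D \<phi> y u) y v"
  let ?e = "dist (?p x) (?q x) / 2"
  assume "?p x \<noteq> ?q x"
  then have e: "?e > 0" by simp
  have "isCont ?p x" "isCont ?q x"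
    using smooth_on_continuous[OF smooth_on_D[OF smooth_on_D[OF \<phi>]]] U
    by (simp_all add: continuous_on_eq_continuous_at)
  then have "\<exists>a>0. \<forall>y. dist y x < a \<longrightarrow> dist (?p y) (?p x) < ?e"
    and "\<exists>b>0. \<forall>y. dist y x < b \<longrightarrow> dist (?q y) (?q x) < ?e"
    unfolding continuous_at_eps_delta using e by blast+
  then obtain a b where a: "a > 0" "\<And>y. dist y x < a \<Longrightarrow> dist (?p y) (?p x) < ?e"
    and b: "b > 0" "\<And>y. dist y x < b \<Longrightarrow> dist (?q y) (?q x) < ?e"
    by blast
  obtain r where r: "r > 0" "ball x r \<subseteq> U"
    using U openE by blast
  define d where "d = min r (min a b)"
  have d: "d > 0" "d \<le> r" "d \<le> a" "d \<le> b" using a b r by (auto simp: d_def)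
  define h where "h = d / (2 * (norm u + norm v + 1))"
  have den: "norm u + norm v + 1 > 0" by (smt (verit) norm_ge_zero)
  have h: "h > 0" using d den by (simp add: h_def)
  have "h * (norm u + norm v) \<le> h * (norm u + norm v + 1)" using h by simp
  also have "\<dots> = d / 2" using den by (simp add: h_def field_simps)
  also have "\<dots> < d" using d by simp
  finally have hd: "h * (norm u + norm v) < d" .
  have diff: "\<phi> differentiable (at y)" "(\<lambda>y. D \<phi> y w) differentiable (at y)" if "y \<in> U" for y w
    using \<phi> that smooth_on_D smooth_on_differentiable by blast+
  obtain y where y: "dist x y \<le> h * (norm u + norm v)"
    "\<phi> (x + h *\<^sub>R u + h *\<^sub>R v) - \<phi> (x + h *\<^sub>R u) - \<phi> (x + h *\<^sub>R v) + \<phi> x = h * h * ?p y"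
    using second_difference_mvt[OF r(2) diff h, of u v] hd d(2) by auto
  obtain z where z: "dist x z \<le> h * (norm u + norm v)"
    "\<phi> (x + h *\<^sub>R v + h *\<^sub>R u) - \<phi> (x + h *\<^sub>R v) - \<phi> (x + h *\<^sub>R u) + \<phi> x = h * h * ?q z"
    using second_difference_mvt[OF r(2) diff h, of v u] hd d(2) by (auto simp: add.commute)
  have "h * h * ?p y = h * h * ?q z"
    using y(2) z(2) by (simp add: algebra_simps)
  then have "?p y = ?q z" using h by simp
  moreover have "dist (?p y) (?p x) < ?e" "dist (?q z) (?q x) < ?e"
    using a(2)[of y] b(2)[of z] y(1) z(1) hd d by (auto simp: dist_commute)
  ultimately show False
    using dist_triangle_half_r[of "?p y" "?p x" "dist (?p x) (?q x)" "?q x"] by simp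
qed

lemma D_D_commute:
  fixes f :: "'a::real_normed_vector \<Rightarrow> 'b::euclidean_space"
  assumes U: "open U" "x \<in> U" and f: "smooth_on U f"
  shows "D (\<lambda>y. D f y v) x u = D (\<lambda>y. D f y u) x v"
proof (rule euclidean_eqI)
  fix b :: 'b
  have inner: "D (\<lambda>y. k y \<bullet> b) y w = D k y w \<bullet> b" if "smooth_on U k" "y \<in> U"
    for k :: "'a \<Rightarrow> 'b" and y w
    using has_derivative_inner_left[OF smooth_on_has_derivative[OF that], of b]
    by (simp add: D_eqI)
  have "D (\<lambda>y. D (\<lambda>y. f y \<bullet> b) y v) x u = D (\<lambda>y. D f y v) x u \<bullet> b" for u v
  proof -
    have "((\<lambda>y. D f y v \<bullet> b) has_derivative (\<lambda>w. D (\<lambda>y. D f y v) x w \<bullet> b)) (at x)"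
      using has_derivative_inner_left[OF smooth_on_has_derivative[OF smooth_on_D[OF f] U(2)]] .
    then have "((\<lambda>y. D (\<lambda>y. f y \<bullet> b) y v) has_derivative (\<lambda>w. D (\<lambda>y. D f y v) x w \<bullet> b)) (at x)"
      by (rule has_derivative_transform_within_open[OF _ U]) (simp add: inner f)
    then show ?thesis by (simp add: D_eqI)
  qed
  then show "D (\<lambda>y. D f y v) x u \<bullet> b = D (\<lambda>y. D f y u) x v \<bullet> b"
    using D_D_commute_real[OF U smooth_on_inner[OF U(1) f smooth_on_const[of U b]], of v u] by simp
qed

section \<open>Inner products, orthonormal and dual bases\<close>

lemma inner_product_rules:
  assumes "inner_product q"
  shows inner_product_commute: "q u v = q v u"
    and inner_product_linear_left: "linear (\<lambda>u. q u w)"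
    and inner_product_linear_right: "linear (\<lambda>u. q w u)"
    and inner_product_pos: "u \<noteq> 0 \<Longrightarrow> q u u > 0"
    and inner_product_ge_0: "q u u \<ge> 0"
    and inner_product_eq_0: "q u u = 0 \<longleftrightarrow> u = 0"
proof -
  show "q u v = q v u" and l: "linear (\<lambda>u. q u w)" "linear (\<lambda>u. q w u)"
    and pos: "u \<noteq> 0 \<Longrightarrow> q u u > 0" for u
    using assms by (auto simp: inner_product_def bilinear_def)
  have "linear (\<lambda>u. q u 0)"
    using assms by (auto simp: inner_product_def bilinear_def)
  from linear_0[OF this] show "q u u \<ge> 0" "q u u = 0 \<longleftrightarrow> u = 0"
    using pos[of u] by (cases "u = 0"; simp)+
qed

lemma inner_product_eqI:
  assumes "inner_product q" "\<And>z. q u z = q v z"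
  shows "u = v"
proof -
  have "q (u - v) (u - v) = 0"
    using assms(2) by (simp add: linear_diff[OF inner_product_linear_left[OF assms(1)]])
  then show ?thesis by (simp add: inner_product_eq_0[OF assms(1)])
qed

lemma orthonormal_coefficient:
  assumes q: "inner_product q" and "finite E"
    and E: "\<And>u v. u \<in> E \<Longrightarrow> v \<in> E \<Longrightarrow> q u v = (if u = v then 1 else 0)" and "e \<in> E"
  shows "q (\<Sum>u\<in>E. a u *\<^sub>R u) e = a e"
proof -
  have "q (\<Sum>u\<in>E. a u *\<^sub>R u) e = (\<Sum>u\<in>E. a u * q u e)"
    by (simp add: linear_sum[OF inner_product_linear_left[OF q]]
        linear_scale[OF inner_product_linear_left[OF q]])
  also have "\<dots> = (\<Sum>u\<in>E. if u = e then a u else 0)"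
    by (intro sum.cong) (auto simp: E \<open>e \<in> E\<close>)
  also have "\<dots> = a e" using assms by simp
  finally show ?thesis .
qed

lemma orthonormal_independent:
  assumes q: "inner_product q" and "finite E"
    and E: "\<And>u v. u \<in> E \<Longrightarrow> v \<in> E \<Longrightarrow> q u v = (if u = v then 1 else 0)"
  shows "independent E"
proof (rule independent_if_scalars_zero[OF \<open>finite E\<close>])
  fix a e assume "(\<Sum>u\<in>E. a u *\<^sub>R u) = 0" "e \<in> E"
  then show "a e = 0"
    using orthonormal_coefficient[where q = q and E = E and a = a and e = e] assms
      linear_0[OF inner_product_linear_left[OF q]] by simp
qed

text \<open>
  One step of the Gram-Schmidt process enlarges any orthonormal set that does not span.
\<close>

lemma exists_orthonormal_basis:
  fixes q :: "'a::euclidean_space \<Rightarrow> 'a \<Rightarrow> real"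
  assumes q: "inner_product q"
  shows "\<exists>E. orthonormal_basis q E"
proof -
  have "\<exists>E. finite E \<and> card E = k \<and> (\<forall>u\<in>E. \<forall>v\<in>E. q u v = (if u = v then 1 else 0))"
    if "k \<le> DIM('a)" for k
    using that
  proof (induction k)
    case 0
    then show ?case by (intro exI[of _ "{}"]) auto
  next
    case (Suc k)
    then obtain E where E: "finite E" "card E = k"
      "\<And>u v. u \<in> E \<Longrightarrow> v \<in> E \<Longrightarrow> q u v = (if u = v then 1 else 0)"
      by auto
    have "dim (span E) \<le> k"
      using dim_le_card'[OF E(1)] E(2) by simp
    with Suc.prems have "dim (span E) < DIM('a)" by linarith
    then have "span E \<noteq> UNIV" by (metis dim_UNIV less_irrefl)
    then obtain v where v: "v \<notin> span E" by auto
    define w where "w = v - (\<Sum>u\<in>E. q v u *\<^sub>R u)"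
    have "(\<Sum>u\<in>E. q v u *\<^sub>R u) \<in> span E"
      by (intro span_sum span_scale span_base)
    then have w_span: "w \<notin> span E"
      using v span_add[of w E "\<Sum>u\<in>E. q v u *\<^sub>R u"] by (auto simp: w_def)
    then have w0: "q w w > 0"
      using inner_product_pos[OF q] span_zero by metis
    have we: "q w e = 0" if "e \<in> E" for e
      using orthonormal_coefficient[OF q E(1,3) that, of "q v"]
      by (simp add: w_def linear_diff[OF inner_product_linear_left[OF q]])
    define e where "e = (1 / sqrt (q w w)) *\<^sub>R w"
    have ee: "q e e = 1"
      using w0 by (simp add: e_def linear_scale[OF inner_product_linear_left[OF q]]
          linear_scale[OF inner_product_linear_right[OF q]])
    have eE: "q e u = 0" "q u e = 0" if "u \<in> E" for u
      using we[OF that] inner_product_commute[OF q, of u e]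
      by (simp_all add: e_def linear_scale[OF inner_product_linear_left[OF q]])
    have "e \<notin> E" using ee eE(1) by fastforce
    then show ?case
      using E ee eE by (intro exI[of _ "insert e E"]) auto
  qed
  from this[of "DIM('a)"] show ?thesis
    by (auto simp: orthonormal_basis_def)
qed

lemma orthonormal_basis_some:
  "inner_product q \<Longrightarrow> orthonormal_basis q (SOME E. orthonormal_basis q E)"
  using exists_orthonormal_basis someI_ex by metis

lemma orthonormal_basis_finite:
  "orthonormal_basis q (E :: 'a::euclidean_space set) \<Longrightarrow> finite E"
  by (metis DIM_positive card.infinite less_not_refl orthonormal_basis_def)

lemma orthonormal_expansion:
  assumes q: "inner_product q" and E: "orthonormal_basis q E"
  shows "(\<Sum>e\<in>E. q u e *\<^sub>R e) = u"
proof -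
  note fin = orthonormal_basis_finite[OF E]
  have on: "\<And>u v. u \<in> E \<Longrightarrow> v \<in> E \<Longrightarrow> q u v = (if u = v then 1 else 0)"
    using E by (auto simp: orthonormal_basis_def)
  have "UNIV \<subseteq> span E"
    using card_ge_dim_independent[of E UNIV] orthonormal_independent[OF q fin on] E
    by (auto simp: orthonormal_basis_def)
  then obtain a where u: "u = (\<Sum>e\<in>E. a e *\<^sub>R e)"
    using span_finite[OF fin] by (metis (no_types, lifting) UNIV_I imageE subsetD)
  have "q u e = a e" if "e \<in> E" for e
    unfolding u by (rule orthonormal_coefficient[OF q fin on that])
  then show ?thesis using u by simp
qed

lemma orthonormal_parseval:
  assumes q: "inner_product q" and E: "orthonormal_basis q E" and L: "linear L"
  shows "(\<Sum>e\<in>E. q u e *\<^sub>R L e) = L u"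
  using orthonormal_expansion[OF q E, of u]
  by (metis (no_types, lifting) L linear_scale linear_sum sum.cong)

lemma riesz_representation:
  fixes q :: "'a::euclidean_space \<Rightarrow> 'a \<Rightarrow> real"
  assumes q: "inner_product q" and L: "linear L"
  shows "\<forall>z. q (THE w. \<forall>z. q w z = L z) z = L z"
proof (rule theI')
  obtain E where E: "orthonormal_basis q E" using exists_orthonormal_basis[OF q] by blast
  show "\<exists>!w. \<forall>z. q w z = L z"
  proof (rule ex1I)
    show "\<forall>z. q (\<Sum>e\<in>E. L e *\<^sub>R e) z = L z"
    proof
      fix z
      have "q (\<Sum>e\<in>E. L e *\<^sub>R e) z = (\<Sum>e\<in>E. q z e *\<^sub>R L e)"
        by (simp add: linear_sum[OF inner_product_linear_left[OF q]] mult.commute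
          linear_scale[OF inner_product_linear_left[OF q]] inner_product_commute[OF q, of z])
      then show "q (\<Sum>e\<in>E. L e *\<^sub>R e) z = L z"
        using orthonormal_parseval[OF q E L] by simp
    qed
    then show "w = (\<Sum>e\<in>E. L e *\<^sub>R e)" if "\<forall>z. q w z = L z" for w
      using that by (intro inner_product_eqI[OF q]) simp
  qed
qed

text \<open>
  The columns of the inverse of the Gram matrix of \<open>q\<close> in the standard basis, characterized without
  reference to matrices.
\<close>

definition dual_basis :: "(real ^ 'm \<Rightarrow> real ^ 'm \<Rightarrow> real) \<Rightarrow> 'm \<Rightarrow> real ^ 'm" where
  "dual_basis q l = (THE w. \<forall>z. q w z = z $ l)"

lemma dual_basis:
  assumes "inner_product q"
  shows "q (dual_basis q l) z = z $ l"
  using riesz_representation[OF assms, of "\<lambda>z. z $ l"]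
  by (simp add: dual_basis_def linear_iff)

lemma vec_expansion: "(\<Sum>l\<in>UNIV. (v $ l) *\<^sub>R axis l 1) = (v :: real ^ 'm)"
  using basis_expansion[of v] by (simp add: scalar_mult_eq_scaleR)

lemma linear_vec_expansion:
  fixes v :: "real ^ 'm"
  assumes "linear L"
  shows "(\<Sum>l\<in>UNIV. (v $ l) *\<^sub>R L (axis l 1)) = L v"
  using vec_expansion[of v] by (metis (no_types, lifting) assms linear_scale linear_sum sum.cong)

text \<open>
  The right-hand side depends on no choice. Expanding the dual basis vectors in the orthonormal
  basis \<open>E\<close> of the trace gives coefficients \<open>q r\<^sub>l e = e\<^sub>l\<close>, which recombine the standard basis
  vectors in the second argument to \<open>e\<close>.
\<close>

lemma metric_trace_dual_basis:
  fixes q :: "real ^ 'm \<Rightarrow> real ^ 'm \<Rightarrow> real" and b :: "real ^ 'm \<Rightarrow> real ^ 'm \<Rightarrow> 'b::real_vector"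
  assumes q: "inner_product q"
    and bl: "\<And>v. linear (\<lambda>u. b u v)" and br: "\<And>u. linear (b u)"
  shows "metric_trace q b = (\<Sum>l\<in>UNIV. b (dual_basis q l) (axis l 1))"
proof -
  define E where "E = (SOME E. orthonormal_basis q E)"
  note E = orthonormal_basis_some[OF q, folded E_def]
  have "b (dual_basis q l) (axis l 1) = (\<Sum>e\<in>E. (e $ l) *\<^sub>R b e (axis l 1))" for l
    using orthonormal_parseval[OF q E bl] by (simp add: dual_basis[OF q] flip: dual_basis[OF q])
  then have "(\<Sum>l\<in>UNIV. b (dual_basis q l) (axis l 1)) =
      (\<Sum>l\<in>UNIV. \<Sum>e\<in>E. (e $ l) *\<^sub>R b e (axis l 1))"
    by simp
  also have "\<dots> = (\<Sum>e\<in>E. \<Sum>l\<in>UNIV. (e $ l) *\<^sub>R b e (axis l 1))"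
    by (rule sum.swap)
  also have "\<dots> = (\<Sum>e\<in>E. b e e)"
    by (simp add: linear_vec_expansion[OF br])
  finally show ?thesis by (simp add: metric_trace_def E_def)
qed

lemma linear_functional_dual_basis:
  fixes q :: "real ^ 'm \<Rightarrow> real ^ 'm \<Rightarrow> real"
  assumes q: "inner_product q" and L: "linear L" and w: "\<And>z. q w z = L z"
  shows "w = (\<Sum>l\<in>UNIV. L (axis l 1) *\<^sub>R dual_basis q l)"
proof (rule inner_product_eqI[OF q])
  fix z
  have "q (\<Sum>l\<in>UNIV. L (axis l 1) *\<^sub>R dual_basis q l) z = (\<Sum>l\<in>UNIV. (z $ l) *\<^sub>R L (axis l 1))"
    by (simp add: linear_sum[OF inner_product_linear_left[OF q]] mult.commute
          linear_scale[OF inner_product_linear_left[OF q]] dual_basis[OF q])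
  then show "q w z = q (\<Sum>l\<in>UNIV. L (axis l 1) *\<^sub>R dual_basis q l) z"
    using w by (simp only: linear_vec_expansion[OF L])
qed

lemma smooth_on_vec_lambda:
  fixes F :: "'m::finite \<Rightarrow> 'a::real_normed_vector \<Rightarrow> real"
  assumes U: "open U" and F: "\<And>k. smooth_on U (F k)"
  shows "smooth_on U (\<lambda>x. \<chi> k. F k x)"
proof -
  have "(\<chi> k. F k x) = (\<Sum>k\<in>UNIV. F k x *\<^sub>R axis k 1)" for x
    using vec_expansion[of "\<chi> k. F k x"] by simp
  then show ?thesis
    by (simp only:) (intro smooth_on_sum U smooth_on_scaleR F smooth_on_const)
qed

text \<open>
  The dual basis vectors solve linear systems with the Gram matrix of \<open>g x\<close> as matrix, which is
  invertible by definiteness. By Cramer's rule their components are quotients of determinants in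
  the smooth entries of the Gram matrix.
\<close>

lemma smooth_on_dual_basis:
  fixes g :: "(real ^ 'm) tensor"
  assumes U: "open U" and g: "\<And>x. x \<in> U \<Longrightarrow> inner_product (g x)"
    and smooth: "\<And>u v. smooth_on U (\<lambda>x. g x u v)"
  shows "smooth_on U (\<lambda>x. dual_basis (g x) l)"
proof -
  define A where "A x = (\<chi> i j. g x (axis i 1) (axis j 1))" for x
  define w where "w x = (\<chi> k. det (\<chi> i j. if j = k then axis l 1 $ i else A x $ i $ j) / det (A x))" for x
  have A: "A x *v v = (\<chi> i. g x (axis i 1) v)" if "x \<in> U" for x v
    using linear_vec_expansion[OF inner_product_linear_right[OF g[OF that]], of v]
    by (simp add: A_def matrix_vector_mult_def vec_eq_iff mult.commute)
  have det: "det (A x) \<noteq> 0" if "x \<in> U" for x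
  proof -
    have "v = 0" if "A x *v v = 0" for v
    proof (rule inner_product_eqI[OF g[OF \<open>x \<in> U\<close>]])
      fix z
      have "g x (axis i 1) v = 0" for i
        using that A[OF \<open>x \<in> U\<close>] by (simp add: vec_eq_iff)
      then have "g x z v = 0"
        using linear_vec_expansion[OF inner_product_linear_left[OF g[OF \<open>x \<in> U\<close>]], of z v] by simp
      then show "g x v z = g x 0 z"
        by (simp add: inner_product_commute[OF g[OF \<open>x \<in> U\<close>], of v]
            linear_0[OF inner_product_linear_left[OF g[OF \<open>x \<in> U\<close>]]])
    qed
    then have "\<exists>B. B ** A x = mat 1"
      by (simp add: matrix_left_invertible_ker)
    then show ?thesis
      by (simp add: invertible_det_nz[symmetric] invertible_left_inverse)
  qed
  have "dual_basis (g x) l = w x" if "x \<in> U" for x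
  proof (rule inner_product_eqI[OF g[OF that]])
    fix z
    have "A x *v w x = axis l 1"
      using cramer[OF det[OF that], of "w x" "axis l 1"] by (simp add: w_def)
    then have "g x (axis i 1) (w x) = axis l 1 $ i" for i
      using A[OF that] by (simp add: vec_eq_iff)
    then have "g x z (w x) = (\<Sum>i\<in>UNIV. (z $ i) *\<^sub>R axis l 1 $ i)"
      using linear_vec_expansion[OF inner_product_linear_left[OF g[OF that]], of z "w x"] by simp
    also have "\<dots> = z $ l"
      by (simp add: axis_def if_distrib[of "(*) _"] cong: if_cong)
    finally show "g x (dual_basis (g x) l) z = g x (w x) z"
      using inner_product_commute[OF g[OF that], of z] dual_basis[OF g[OF that]] by simp
  qed
  moreover have "smooth_on U w"
    unfolding w_def
  proof (intro smooth_on_vec_lambda U smooth_on_divide det)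
    have entry: "smooth_on U (\<lambda>x. A x $ i $ j)" for i j
      by (simp add: A_def smooth)
    then show "smooth_on U (\<lambda>x. det (A x))"
      by (intro smooth_on_det U)
    show "smooth_on U (\<lambda>x. det (\<chi> i j. if j = k then axis l 1 $ i else A x $ i $ j))" for k
    proof (intro smooth_on_det U)
      show "smooth_on U (\<lambda>x. (\<chi> i j. if j = k then axis l 1 $ i else A x $ i $ j) $ i $ j)" for i j
        using entry by (cases "j = k") (auto intro: smooth_on_const)
    qed
  qed
  ultimately show ?thesis
    by (rule smooth_on_transform[OF U, rotated])
qed

lemma smooth_on_D_apply:
  fixes f :: "real ^ 'm \<Rightarrow> 'b::euclidean_space"
  assumes U: "open U" and f: "smooth_on U f" and V: "smooth_on U V"
  shows "smooth_on U (\<lambda>x. D f x (V x))"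
proof -
  have "smooth_on U (\<lambda>x. \<Sum>l\<in>UNIV. (V x $ l) *\<^sub>R D f x (axis l 1))"
    by (intro smooth_on_sum smooth_on_scaleR smooth_on_D f U
        smooth_on_linear[OF bounded_linear_vec_nth _ V])
  then show ?thesis
    by (rule smooth_on_transform[OF U])
      (rule linear_vec_expansion[symmetric],
        rule has_derivative_linear[OF smooth_on_has_derivative[OF f]])
qed

section \<open>The Fubini-Study metric in an affine chart\<close>

lemma complex_structure_add: "complex_structure (u + v) = complex_structure u + complex_structure v"
  and complex_structure_diff: "complex_structure (u - v) = complex_structure u - complex_structure v"
  and complex_structure_minus: "complex_structure (- u) = - complex_structure u"
  and complex_structure_scaleR: "complex_structure (r *\<^sub>R u) = r *\<^sub>R complex_structure u"
  and complex_structure_twice: "complex_structure (complex_structure u) = - u"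
  by (simp_all add: complex_structure_def vec_eq_iff algebra_simps)

lemma inner_complex_structure: "complex_structure u \<bullet> v = - (u \<bullet> complex_structure v)"
  by (simp add: complex_structure_def inner_vec_def inner_complex_def algebra_simps
      flip: sum_negf)

lemma inner_complex_structure_self: "u \<bullet> complex_structure u = 0"
  using inner_complex_structure[of u u] by (simp add: inner_commute)

lemma bounded_linear_complex_structure: "bounded_linear complex_structure"
  by (simp add: linear_linear linear_iff complex_structure_add complex_structure_scaleR)

lemmas complex_structure_simps =
  complex_structure_add complex_structure_diff complex_structure_minus complex_structure_scaleR
  complex_structure_twice inner_complex_structure inner_complex_structure_self

text \<open>
  The Fubini-Study metric in affine coordinates in real terms: with the Hermitian product
  \<open>\<langle>u,v\<rangle> = u \<bullet> v + \<i> (u \<bullet> Jv)\<close> it is the real part of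
  \<open>\<langle>u,v\<rangle> / (1 + |z|\<^sup>2) - \<langle>u,z\<rangle> \<langle>z,v\<rangle> / (1 + |z|\<^sup>2)\<^sup>2\<close>.
\<close>

definition fs_metric :: "(complex ^ 'n::finite) tensor" where
  "fs_metric z u v = (u \<bullet> v) / (1 + z \<bullet> z) -
     ((u \<bullet> z) * (v \<bullet> z) + (u \<bullet> complex_structure z) * (v \<bullet> complex_structure z)) / (1 + z \<bullet> z)\<^sup>2"

text \<open>
  The Christoffel symbols of the Kaehler metric with potential \<open>log (1 + |z|\<^sup>2)\<close>, which are
  \<open>- (\<langle>u,z\<rangle> v + \<langle>v,z\<rangle> u) / (1 + |z|\<^sup>2)\<close> with the same Hermitian product.
\<close>

definition fs_gamma :: "complex ^ 'n::finite \<Rightarrow> complex ^ 'n \<Rightarrow> complex ^ 'n \<Rightarrow> complex ^ 'n" where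
  "fs_gamma z u v = - (1 / (1 + z \<bullet> z)) *\<^sub>R
     ((u \<bullet> z) *\<^sub>R v + (u \<bullet> complex_structure z) *\<^sub>R complex_structure v +
      ((v \<bullet> z) *\<^sub>R u + (v \<bullet> complex_structure z) *\<^sub>R complex_structure u))"

lemma one_plus_inner_pos: "1 + z \<bullet> z > (0::real)"
  by (simp add: add_pos_nonneg)

subsection \<open>Comparison with homogeneous coordinates\<close>

text \<open>
  The affine coordinates in the chart \<open>i\<close> are stored at the homogeneous positions different from
  \<open>i\<close>, each exactly once; this reduces Hermitian products of homogeneous coordinates to those of
  affine ones.
\<close>

lemma sum_over_option_without:
  fixes i :: "'n::finite option" and F :: "'n \<Rightarrow> 'b::comm_monoid_add"
  shows "(\<Sum>j\<in>UNIV. if j = i then c else F (case j of Some k \<Rightarrow> k | None \<Rightarrow> the i)) = c + (\<Sum>k\<in>UNIV. F k)"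
proof (cases i)
  case None
  then show ?thesis by (simp add: UNIV_option_conv sum.reindex)
next
  case (Some l)
  have "(\<Sum>j\<in>UNIV. if j = i then c else F (case j of Some k \<Rightarrow> k | None \<Rightarrow> the i)) =
      F l + (\<Sum>k\<in>UNIV. if k = l then c else F k)"
    using Some by (simp add: UNIV_option_conv sum.reindex cong: if_cong)
  also have "\<dots> = F l + (c + (\<Sum>k\<in>UNIV - {l}. F k))"
    by (subst sum.remove[of UNIV l]) (auto intro: arg_cong2[where f = "(+)"] sum.cong)
  also have "\<dots> = c + (\<Sum>k\<in>UNIV. F k)"
    by (simp add: sum.remove[of UNIV l F] add.left_commute)
  finally show ?thesis .
qed

lemma D_affine_lift:
  "D (affine_lift i) z u = (\<chi> j. if j = i then 0 else u $ (case j of Some k \<Rightarrow> k | None \<Rightarrow> the i))"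
proof -
  let ?L = "\<lambda>u. (\<chi> j. if j = i then 0 else u $ (case j of Some k \<Rightarrow> k | None \<Rightarrow> the i)) :: complex ^ 'a option"
  have "linear ?L"
    by (auto simp: linear_iff vec_eq_iff)
  then have "(?L has_derivative ?L) (at z)"
    by (simp add: linear_linear bounded_linear_imp_has_derivative)
  then have "((\<lambda>z. affine_lift i 0 + ?L z) has_derivative ?L) (at z)"
    by (auto intro!: derivative_eq_intros)
  moreover have "(\<lambda>z. affine_lift i 0 + ?L z) = affine_lift i"
    by (auto simp: affine_lift_def fun_eq_iff vec_eq_iff split: option.splits)
  ultimately show ?thesis by (simp add: D_eqI)
qed

lemma affine_lift_nth:
  "affine_lift i z $ j = (if j = i then 1 else z $ (case j of Some k \<Rightarrow> k | None \<Rightarrow> the i))"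
  by (auto simp: affine_lift_def split: option.splits)

lemma sum_mult_cnj:
  "(\<Sum>k\<in>UNIV. u $ k * cnj (v $ k)) = Complex (u \<bullet> v) (u \<bullet> complex_structure v)"
  by (simp add: complex_eq_iff inner_vec_def inner_complex_def complex_structure_def algebra_simps)

lemma chart_met_affine_chart: "chart_met (affine_chart i) = fs_metric"
proof (intro ext)
  fix z u v :: "complex ^ 'a"
  let ?s = "1 + z \<bullet> z"
  have prod: "(if j = i then a else u $ k) * cnj (if j = i then b else v $ k) =
      (if j = i then a * cnj b else u $ k * cnj (v $ k))" for a b u v j k
    by simp
  have herm:
    "hermitian (affine_lift i z) (affine_lift i z) = of_real ?s"
    "hermitian (D (affine_lift i) z u) (D (affine_lift i) z v) = Complex (u \<bullet> v) (u \<bullet> complex_structure v)"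
    "hermitian (D (affine_lift i) z u) (affine_lift i z) = Complex (u \<bullet> z) (u \<bullet> complex_structure z)"
    "hermitian (affine_lift i z) (D (affine_lift i) z v) = Complex (z \<bullet> v) (z \<bullet> complex_structure v)"
    unfolding hermitian_def D_affine_lift affine_lift_nth vec_lambda_beta prod
      sum_over_option_without[where F = "\<lambda>k. x $ k * cnj (y $ k)" for x y] sum_mult_cnj
    by (simp_all add: complex_eq_iff inner_complex_structure_self)
  have zv: "z \<bullet> complex_structure v = - (v \<bullet> complex_structure z)"
    using inner_complex_structure[of z v] by (simp add: inner_commute)
  have "chart_met (affine_chart i) z u v = fubini_study (affine_lift i z)
      (D (affine_lift i) z u) (D (affine_lift i) z v)"
    by (simp add: affine_chart_def)
  also have "\<dots> = fs_metric z u v"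
    unfolding fubini_study_def herm zv of_real_power[symmetric]
    by (simp add: Re_divide_of_real fs_metric_def inner_commute[of z v] del: of_real_power of_real_add)
  finally show "chart_met (affine_chart i) z u v = fs_metric z u v" .
qed

subsection \<open>Levi-Civita connection and curvature\<close>

lemma fs_metric_commute: "fs_metric z u v = fs_metric z v u"
  by (simp add: fs_metric_def inner_commute mult.commute)

lemma fs_metric_linear_left: "linear (\<lambda>u. fs_metric z u v)"
  by (simp add: linear_iff fs_metric_def inner_add_left algebra_simps add_divide_distrib)

lemma fs_metric_linear_right: "linear (fs_metric z u)"
  using fs_metric_linear_left[of z u] fs_metric_commute[of z u] by presburger

text \<open>
  The left-hand side is \<open>|\<langle>u,z\<rangle>|\<^sup>2\<close> for the Hermitian product.
\<close>

lemma hermitian_Cauchy_Schwarz: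
  "(u \<bullet> z)\<^sup>2 + (u \<bullet> complex_structure z)\<^sup>2 \<le> (u \<bullet> u) * (z \<bullet> z)"
proof (cases "z = 0")
  case True
  then show ?thesis by (simp add: complex_structure_def)
next
  case False
  \<comment> \<open>a multiple of the component of \<open>u\<close> orthogonal to the complex line through \<open>z\<close>\<close>
  define w where "w = (z \<bullet> z) *\<^sub>R u - (u \<bullet> z) *\<^sub>R z - (u \<bullet> complex_structure z) *\<^sub>R complex_structure z"
  have zu: "z \<bullet> complex_structure u = - (u \<bullet> complex_structure z)"
    using inner_complex_structure[of z u] by (simp add: inner_commute)
  have "w \<bullet> w = (z \<bullet> z) * ((u \<bullet> u) * (z \<bullet> z) - ((u \<bullet> z)\<^sup>2 + (u \<bullet> complex_structure z)\<^sup>2))"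
    by (simp add: w_def inner_diff_left inner_diff_right complex_structure_simps inner_commute[of z u]
        zu power2_eq_square algebra_simps)
  moreover have "w \<bullet> w \<ge> 0" "z \<bullet> z > 0" using False by auto
  ultimately show ?thesis
    by (simp add: zero_le_mult_iff)
qed

lemma inner_product_fs_metric: "inner_product (fs_metric z)"
  unfolding inner_product_def bilinear_def
proof (intro conjI allI impI)
  show "linear (fs_metric z u)" "linear (\<lambda>u. fs_metric z u v)" "fs_metric z u v = fs_metric z v u" for u v
    by (rule fs_metric_linear_right fs_metric_linear_left fs_metric_commute)+
  fix u :: "complex ^ 'a" assume "u \<noteq> 0"
  define s where "s = 1 + z \<bullet> z"
  have s: "s > 0" "z \<bullet> z = s - 1"
    using one_plus_inner_pos[of z] by (simp_all add: s_def)
  have "fs_metric z u u = ((u \<bullet> u) * s - ((u \<bullet> z)\<^sup>2 + (u \<bullet> complex_structure z)\<^sup>2)) / s\<^sup>2"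
    unfolding fs_metric_def s_def[symmetric] using s(1) by (simp add: field_simps power2_eq_square)
  also have "\<dots> > 0"
  proof (rule divide_pos_pos)
    have "(u \<bullet> u) * s = u \<bullet> u + (u \<bullet> u) * (z \<bullet> z)"
      by (simp add: s_def distrib_left)
    moreover have "u \<bullet> u > 0" using \<open>u \<noteq> 0\<close> by simp
    ultimately show "(u \<bullet> u) * s - ((u \<bullet> z)\<^sup>2 + (u \<bullet> complex_structure z)\<^sup>2) > 0"
      using hermitian_Cauchy_Schwarz[of u z] by linarith
  qed (use s in simp)
  finally show "fs_metric z u u > 0" .
qed

lemma fs_gamma_commute: "fs_gamma z u v = fs_gamma z v u"
  by (simp add: fs_gamma_def add.commute)

lemma fs_gamma_linear_right: "linear (fs_gamma z u)"
  by (simp add: linear_iff fs_gamma_def complex_structure_simps algebra_simps inner_add_left)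

lemma fs_gamma_linear_left: "linear (\<lambda>u. fs_gamma z u v)"
  using fs_gamma_linear_right[of z v] by (simp add: fs_gamma_commute[of z _ v])

text \<open>
  The right-hand side is the derivative, in the direction \<open>a\<close>, of the coefficient
  \<open>fs_metric z v w\<close> as a function of \<open>z\<close>. The identity thus says that \<open>fs_gamma\<close> is a metric
  connection.
\<close>

lemma fs_metric_gamma:
  "fs_metric z (fs_gamma z a v) w + fs_metric z v (fs_gamma z a w) =
    - (2 * (a \<bullet> z) * (v \<bullet> w)) / (1 + z \<bullet> z)\<^sup>2
    - ((v \<bullet> a) * (w \<bullet> z) + (v \<bullet> z) * (w \<bullet> a) +
        (v \<bullet> complex_structure a) * (w \<bullet> complex_structure z) +
        (v \<bullet> complex_structure z) * (w \<bullet> complex_structure a)) / (1 + z \<bullet> z)\<^sup>2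
    + 4 * (a \<bullet> z) * ((v \<bullet> z) * (w \<bullet> z) + (v \<bullet> complex_structure z) * (w \<bullet> complex_structure z)) / (1 + z \<bullet> z) ^ 3"
proof -
  have flip: "w \<bullet> v = v \<bullet> w" "a \<bullet> v = v \<bullet> a" "a \<bullet> w = w \<bullet> a"
    "w \<bullet> complex_structure v = - (v \<bullet> complex_structure w)"
    "a \<bullet> complex_structure v = - (v \<bullet> complex_structure a)"
    "a \<bullet> complex_structure w = - (w \<bullet> complex_structure a)"
    by (metis inner_commute inner_complex_structure)+
  define s where "s = 1 + z \<bullet> z"
  have zz: "z \<bullet> z = s - 1" and s: "s \<noteq> 0"
    using one_plus_inner_pos[of z] by (auto simp: s_def)
  show ?thesis
    using s unfolding fs_metric_def fs_gamma_def s_def[symmetric]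
    by (simp add: inner_add_left inner_add_right complex_structure_simps flip zz
        divide_simps power2_eq_square power3_eq_cube) algebra
qed

text \<open>
  The product rule for vector fields along a map, with respect to the connection pulled back from
  the projective space. Constant fields and the identity map give back the metric property of
  \<open>fs_gamma\<close>, which together with its symmetry identifies it as the Levi-Civita connection.
\<close>

lemma fs_metric_has_derivative:
  fixes f :: "'a::real_normed_vector \<Rightarrow> complex ^ 'n::finite"
  assumes f: "(f has_derivative f') (at x)" and V: "(V has_derivative V') (at x)"
    and W: "(W has_derivative W') (at x)"
  shows "((\<lambda>y. fs_metric (f y) (V y) (W y)) has_derivative
    (\<lambda>a. fs_metric (f x) (V' a + fs_gamma (f x) (f' a) (V x)) (W x) +
         fs_metric (f x) (V x) (W' a + fs_gamma (f x) (f' a) (W x)))) (at x)"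
proof -
  define s where "s = 1 + f x \<bullet> f x"
  have s: "s \<noteq> 0"
    using one_plus_inner_pos[of "f x"] by (auto simp: s_def)
  have nz: "1 + f x \<bullet> f x \<noteq> 0" "(1 + f x \<bullet> f x)\<^sup>2 \<noteq> 0"
    using s by (auto simp: s_def)
  note J = bounded_linear.has_derivative[OF bounded_linear_complex_structure f]
  have "((\<lambda>y. fs_metric (f y) (V y) (W y)) has_derivative
    (\<lambda>a. (fs_metric (f x) (V' a) (W x) + fs_metric (f x) (V x) (W' a)) +
      (fs_metric (f x) (fs_gamma (f x) (f' a) (V x)) (W x) +
       fs_metric (f x) (V x) (fs_gamma (f x) (f' a) (W x))))) (at x)"
    unfolding fs_metric_gamma
    unfolding fs_metric_def
    apply (rule has_derivative_eq_rhs)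
     apply (rule derivative_eq_intros refl f V W J nz)+
    apply (rule ext)
    using s unfolding s_def[symmetric]
    apply (simp add: divide_simps power2_eq_square power3_eq_cube inner_commute)
    apply algebra
    done
  then show ?thesis
    by (simp add: linear_add[OF fs_metric_linear_left] linear_add[OF fs_metric_linear_right] algebra_simps)
qed

lemma christoffel_fs_metric: "christoffel fs_metric = fs_gamma"
proof (intro ext)
  fix z u v :: "complex ^ 'a"
  have deriv: "D (\<lambda>y. fs_metric y v w) z a =
      fs_metric z (fs_gamma z a v) w + fs_metric z v (fs_gamma z a w)" for v w a
    using fs_metric_has_derivative[OF has_derivative_ident has_derivative_const has_derivative_const,
        of v w z]
    by (simp add: D_eqI)
  have koszul: "(D (\<lambda>y. fs_metric y v w) z u + D (\<lambda>y. fs_metric y u w) z v - D (\<lambda>y. fs_metric y u v) z w) / 2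
      = fs_metric z (fs_gamma z u v) w" for w
    unfolding deriv
    by (simp add: fs_gamma_commute[of z v u] fs_gamma_commute[of z w] fs_metric_commute[of z v]
        fs_metric_commute[of z u])
  show "christoffel fs_metric z u v = fs_gamma z u v"
    unfolding christoffel_def koszul
    by (rule the_equality) (auto intro: inner_product_eqI[OF inner_product_fs_metric])
qed

lemma fs_gamma_has_derivative:
  "((\<lambda>z. fs_gamma z v w) has_derivative (\<lambda>u. (2 * (u \<bullet> z) / (1 + z \<bullet> z)\<^sup>2) *\<^sub>R
      ((v \<bullet> z) *\<^sub>R w + (v \<bullet> complex_structure z) *\<^sub>R complex_structure w +
       ((w \<bullet> z) *\<^sub>R v + (w \<bullet> complex_structure z) *\<^sub>R complex_structure v)) -
     (1 / (1 + z \<bullet> z)) *\<^sub>R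
      ((v \<bullet> u) *\<^sub>R w + (v \<bullet> complex_structure u) *\<^sub>R complex_structure w +
       ((w \<bullet> u) *\<^sub>R v + (w \<bullet> complex_structure u) *\<^sub>R complex_structure v)))) (at z)"
proof -
  note J = bounded_linear.has_derivative[OF bounded_linear_complex_structure has_derivative_ident]
  have nz: "1 + z \<bullet> z \<noteq> 0"
    using one_plus_inner_pos[of z] by auto
  show ?thesis
    unfolding fs_gamma_def
    apply (rule has_derivative_eq_rhs)
     apply (rule derivative_eq_intros refl J nz)+
    apply (rule ext)
    apply (simp add: inner_commute power2_eq_square divide_inverse mult.commute mult.left_commute)
    done
qed

text \<open>
  The operator \<open>v \<mapsto> R(u,v)u\<close> is all of the curvature tensor that enters the bitension. For
  \<open>v = Ju\<close> the value is \<open>- 4 \<langle>u,u\<rangle> Ju\<close>, the constant holomorphic sectional curvature being 4.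
\<close>

lemma curvature_fs_metric:
  "curvature fs_metric z u v u =
    fs_metric z u v *\<^sub>R u - fs_metric z u u *\<^sub>R v
      + (3 * fs_metric z u (complex_structure v)) *\<^sub>R complex_structure u"
proof -
  have nabla: "levi_civita fs_metric (\<lambda>_. a) (\<lambda>_. b) = (\<lambda>z. fs_gamma z a b)" for a b :: "complex ^ 'a"
    by (simp add: levi_civita_def christoffel_fs_metric fun_eq_iff)
  have bracket: "lie_bracket (\<lambda>_. u) (\<lambda>_. v) = (\<lambda>_. 0)"
    by (simp add: lie_bracket_def fun_eq_iff)
  have zero: "fs_gamma z 0 w = 0" for w
    using linear_0[OF fs_gamma_linear_left] .
  have flip: "v \<bullet> u = u \<bullet> v" "v \<bullet> complex_structure u = - (u \<bullet> complex_structure v)"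
    by (metis inner_commute inner_complex_structure)+
  have double: "complex_structure (2 * x) = complex_structure x + complex_structure x"
    "(2 * x) \<bullet> y = 2 * (x \<bullet> y)" for x y :: "complex ^ 'a"
    by (simp_all only: mult_2 complex_structure_add inner_add_left)
  define s where "s = 1 + z \<bullet> z"
  have zz: "z \<bullet> z = s - 1" and s: "s \<noteq> 0"
    using one_plus_inner_pos[of z] by (auto simp: s_def)
  have R: "curvature fs_metric z u v u =
      D (\<lambda>z. fs_gamma z v u) z u + fs_gamma z u (fs_gamma z v u)
      - (D (\<lambda>z. fs_gamma z u u) z v + fs_gamma z v (fs_gamma z u u))"
    by (simp add: curvature_def curvature_field_def nabla bracket zero)
      (simp add: levi_civita_def christoffel_fs_metric)
  show ?thesis
  proof (rule euclidean_eqI)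
    fix b :: "complex ^ 'a"
    show "curvature fs_metric z u v u \<bullet> b = (fs_metric z u v *\<^sub>R u - fs_metric z u u *\<^sub>R v
      + (3 * fs_metric z u (complex_structure v)) *\<^sub>R complex_structure u) \<bullet> b"
      unfolding R D_eqI[OF fs_gamma_has_derivative]
      using s unfolding fs_metric_def fs_gamma_def s_def[symmetric]
      by (simp add: inner_add_left inner_add_right inner_diff_left complex_structure_simps flip zz double
          divide_simps power2_eq_square) algebra
  qed
qed

section \<open>Submanifolds of complex projective space in a chart\<close>

lemma smooth_on_fs_gamma:
  assumes U: "open U" and f: "smooth_on U f" and V: "smooth_on U V" and W: "smooth_on U W"
  shows "smooth_on U (\<lambda>y. fs_gamma (f y) (V y) (W y))"
proof -
  have "1 + f y \<bullet> f y \<noteq> 0" for y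
    using one_plus_inner_pos[of "f y"] by simp
  then show ?thesis
    unfolding fs_gamma_def
    by (intro smooth_on_scaleR smooth_on_minus smooth_on_divide smooth_on_add smooth_on_inner
        smooth_on_const smooth_on_linear[OF bounded_linear_complex_structure] U f V W)
qed

lemma smooth_on_fs_metric:
  assumes U: "open U" and f: "smooth_on U f" and V: "smooth_on U V" and W: "smooth_on U W"
  shows "smooth_on U (\<lambda>y. fs_metric (f y) (V y) (W y))"
proof -
  have "1 + f y \<bullet> f y \<noteq> 0" "(1 + f y \<bullet> f y) * (1 + f y \<bullet> f y) \<noteq> 0" for y
    using one_plus_inner_pos[of "f y"] by simp_all
  then show ?thesis
    unfolding fs_metric_def power2_eq_square
    by (intro smooth_on_mult smooth_on_diff smooth_on_divide smooth_on_add smooth_on_inner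
        smooth_on_const smooth_on_linear[OF bounded_linear_complex_structure] U f V W)
qed

text \<open>
  The coordinate expression of an immersed submanifold, in a chart of the submanifold and an affine
  chart of the projective space. The differential of \<open>f\<close> is injective because \<open>g\<close> is definite.
\<close>

locale immersion_into_cpn =
  fixes g :: "(real ^ 'm) tensor" and f :: "real ^ 'm \<Rightarrow> complex ^ 'n::finite" and U :: "(real ^ 'm) set"
  assumes U: "open U"
    and inner_product_g: "x \<in> U \<Longrightarrow> inner_product (g x)"
    and smooth_g: "smooth_on U (\<lambda>x. g x u v)"
    and smooth_f: "smooth_on U f"
    and isometric: "x \<in> U \<Longrightarrow> g x u v = fs_metric (f x) (D f x u) (D f x v)"
begin

abbreviation "nabla \<equiv> pullback_conn fs_metric f"
abbreviation "H \<equiv> mean_curvature g fs_metric f"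
abbreviation "tau \<equiv> tension g fs_metric f"
abbreviation "B \<equiv> nabla_df g fs_metric f"
abbreviation "A \<equiv> weingarten fs_metric f H"
abbreviation "h x \<equiv> fs_metric (f x)"

lemmas h_simps = linear_add[OF fs_metric_linear_left] linear_add[OF fs_metric_linear_right]
  linear_diff[OF fs_metric_linear_left] linear_diff[OF fs_metric_linear_right]
  linear_scale[OF fs_metric_linear_left] linear_scale[OF fs_metric_linear_right]
  linear_neg[OF fs_metric_linear_left] linear_neg[OF fs_metric_linear_right]
  linear_0[OF fs_metric_linear_left] linear_0[OF fs_metric_linear_right]
  linear_sum[OF fs_metric_linear_left] linear_sum[OF fs_metric_linear_right]

lemma linear_D_f: "x \<in> U \<Longrightarrow> linear (D f x)"
  using has_derivative_linear smooth_on_has_derivative smooth_f by blast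

lemma nabla_eq: "nabla V x u = D V x u + fs_gamma (f x) (D f x u) (V x)"
  by (simp add: pullback_conn_def christoffel_fs_metric)

lemma linear_nabla:
  assumes "smooth_on U V" "x \<in> U"
  shows "linear (nabla V x)"
proof -
  have "linear (D V x)"
    using has_derivative_linear smooth_on_has_derivative assms by blast
  moreover have "linear (\<lambda>u. fs_gamma (f x) (D f x u) (V x))"
    using linear_compose[OF linear_D_f[OF assms(2)] fs_gamma_linear_left] by (simp add: o_def)
  ultimately show ?thesis
    unfolding nabla_eq by (rule linear_compose_add)
qed

lemma smooth_on_nabla: "smooth_on U V \<Longrightarrow> smooth_on U (\<lambda>y. nabla V y u)"
  unfolding nabla_eq by (intro smooth_on_add smooth_on_D smooth_on_fs_gamma U smooth_f)

lemma nabla_scale: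
  assumes W: "smooth_on U W" and V: "\<And>y. y \<in> U \<Longrightarrow> V y = r *\<^sub>R W y" and x: "x \<in> U"
  shows "nabla V x u = r *\<^sub>R nabla W x u"
proof -
  have "((\<lambda>y. r *\<^sub>R W y) has_derivative (\<lambda>u. r *\<^sub>R D W x u)) (at x)"
    by (intro has_derivative_scaleR_right smooth_on_has_derivative[OF W x])
  then have "(V has_derivative (\<lambda>u. r *\<^sub>R D W x u)) (at x)"
    by (rule has_derivative_transform_within_open[OF _ U x]) (simp add: V)
  then show ?thesis
    by (simp add: nabla_eq D_eqI V[OF x] scaleR_add_right linear_scale[OF fs_gamma_linear_right])
qed

lemma nabla_metric:
  assumes V: "smooth_on U V" and W: "smooth_on U W" and x: "x \<in> U"
  shows "((\<lambda>y. h y (V y) (W y)) has_derivative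
    (\<lambda>u. h x (nabla V x u) (W x) + h x (V x) (nabla W x u))) (at x)"
  unfolding nabla_eq
  by (rule fs_metric_has_derivative) (rule smooth_on_has_derivative[OF _ x], fact smooth_f V W)+

text \<open>
  The constant is zero for \<open>H\<close> and a tangent field, and for \<open>H\<close> and its covariant derivative; for \<open>H\<close>
  and itself it is the square of the mean curvature.
\<close>

lemma nabla_metric_const:
  assumes V: "smooth_on U V" and W: "smooth_on U W" and x: "x \<in> U"
    and const: "\<And>y. y \<in> U \<Longrightarrow> h y (V y) (W y) = r"
  shows "h x (nabla V x u) (W x) + h x (V x) (nabla W x u) = 0"
proof -
  have "((\<lambda>y. h y (V y) (W y)) has_derivative (\<lambda>u. 0)) (at x)"
    by (rule has_derivative_transform_within_open[OF has_derivative_const[of r] U x])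
      (simp add: const)
  from has_derivative_unique[OF this nabla_metric[OF V W x]] show ?thesis
    by metis
qed

lemma nabla_torsion_free:
  "x \<in> U \<Longrightarrow> nabla (\<lambda>y. D f y v) x u = nabla (\<lambda>y. D f y u) x v"
  by (simp add: nabla_eq D_D_commute[OF U _ smooth_f, of x v u] fs_gamma_commute)

text \<open>
  The Levi-Civita connection of the induced metric is the tangential part of the ambient one. The
  ambient connection is metric and torsion free along \<open>f\<close>, so the sum in the Koszul formula for \<open>g\<close>
  collapses to the right-hand side.
\<close>

lemma christoffel_g:
  assumes x: "x \<in> U"
  shows "g x (christoffel g x u v) w = h x (nabla (\<lambda>y. D f y v) x u) (D f x w)"
proof -
  let ?P = "\<lambda>u v w. h x (nabla (\<lambda>y. D f y v) x u) (D f x w)"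
  have D_g: "D (\<lambda>y. g y v w) x u = ?P u v w + ?P u w v" for u v w
  proof -
    have "((\<lambda>y. g y v w) has_derivative (\<lambda>u. h x (nabla (\<lambda>y. D f y v) x u) (D f x w) +
        h x (D f x v) (nabla (\<lambda>y. D f y w) x u))) (at x)"
      by (rule has_derivative_transform_within_open[OF
            nabla_metric[OF smooth_on_D[OF smooth_f] smooth_on_D[OF smooth_f] x] U x])
        (simp add: isometric)
    then show ?thesis by (simp add: D_eqI fs_metric_commute)
  qed
  have koszul: "(D (\<lambda>y. g y v w) x u + D (\<lambda>y. g y u w) x v - D (\<lambda>y. g y u v) x w) / 2 = ?P u v w" for w
    unfolding D_g using nabla_torsion_free[OF x] by simp
  have "linear (\<lambda>w. ?P u v w)"
    using linear_compose[OF linear_D_f[OF x] fs_metric_linear_right] by (simp add: o_def)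
  from riesz_representation[OF inner_product_g[OF x] this] show ?thesis
    unfolding christoffel_def koszul by blast
qed

lemma christoffel_g_commute:
  assumes x: "x \<in> U"
  shows "christoffel g x u v = christoffel g x v u"
  by (rule inner_product_eqI[OF inner_product_g[OF x]])
    (simp only: christoffel_g[OF x] nabla_torsion_free[OF x, of v u])

lemma linear_christoffel_g:
  assumes x: "x \<in> U"
  shows "linear (\<lambda>u. christoffel g x u v)"
proof -
  note lin = linear_nabla[OF smooth_on_D[OF smooth_f] x, of v]
  note gl = inner_product_linear_left[OF inner_product_g[OF x]]
  show ?thesis
    by (rule linearI; rule inner_product_eqI[OF inner_product_g[OF x]])
      (simp_all add: christoffel_g[OF x] linear_add[OF gl] linear_scale[OF gl] linear_add[OF lin]
        linear_scale[OF lin] h_simps)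
qed

lemma smooth_on_christoffel_g: "smooth_on U (\<lambda>x. christoffel g x u v)"
proof (rule smooth_on_transform[OF U])
  let ?L = "\<lambda>x w. h x (nabla (\<lambda>y. D f y v) x u) (D f x w)"
  show "smooth_on U (\<lambda>x. \<Sum>l\<in>UNIV. ?L x (axis l 1) *\<^sub>R dual_basis (g x) l)"
    by (intro smooth_on_sum smooth_on_scaleR smooth_on_fs_metric smooth_on_nabla smooth_on_D
        smooth_on_dual_basis inner_product_g smooth_g smooth_f U)
  fix x assume x: "x \<in> U"
  have "linear (?L x)"
    using linear_compose[OF linear_D_f[OF x] fs_metric_linear_right] by (simp add: o_def)
  then show "christoffel g x u v = (\<Sum>l\<in>UNIV. ?L x (axis l 1) *\<^sub>R dual_basis (g x) l)"
    by (rule linear_functional_dual_basis[OF inner_product_g[OF x]]) (rule christoffel_g[OF x])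
qed

subsection \<open>Second fundamental form and mean curvature\<close>

lemma B_eq: "B x u v = nabla (\<lambda>y. D f y v) x u - D f x (christoffel g x u v)"
  by (simp add: nabla_df_def)

lemma B_commute: "x \<in> U \<Longrightarrow> B x u v = B x v u"
  by (simp only: B_eq nabla_torsion_free[of x v u] christoffel_g_commute[of x u v])

lemma linear_B_left:
  assumes x: "x \<in> U"
  shows "linear (\<lambda>u. B x u v)"
  unfolding B_eq
  using linear_compose[OF linear_christoffel_g[OF x, of v] linear_D_f[OF x]]
  by (intro linear_compose_sub linear_nabla[OF smooth_on_D[OF smooth_f] x]) (simp add: o_def)

lemma linear_B_right:
  assumes x: "x \<in> U"
  shows "linear (B x u)"
  using linear_B_left[OF x, of u] unfolding B_commute[OF x, of _ u] .

lemma B_normal: "x \<in> U \<Longrightarrow> h x (B x u v) (D f x w) = 0"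
  by (simp add: B_eq h_simps christoffel_g flip: isometric)

lemma smooth_on_B: "smooth_on U (\<lambda>x. B x u v)"
  unfolding B_eq
  by (intro smooth_on_diff smooth_on_nabla smooth_on_D smooth_on_D_apply smooth_on_christoffel_g
      smooth_f U)

lemma tangent_part_unique:
  assumes x: "x \<in> U" and u: "\<And>z. h x w (D f x z) = g x u z"
  shows "tangent_part fs_metric f x w = u"
  unfolding tangent_part_def
proof (rule the_equality)
  show "normal_vector fs_metric f x (w - D f x u)"
    using u by (simp add: normal_vector_def h_simps isometric[OF x])
  show "v = u" if "normal_vector fs_metric f x (w - D f x v)" for v
    using that u
    by (intro inner_product_eqI[OF inner_product_g[OF x]])
      (simp add: normal_vector_def h_simps isometric[OF x])
qed

lemma g_tangent_part:
  assumes x: "x \<in> U"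
  shows "g x (tangent_part fs_metric f x w) z = h x w (D f x z)"
proof -
  have "linear (\<lambda>z. h x w (D f x z))"
    using linear_compose[OF linear_D_f[OF x] fs_metric_linear_right] by (simp add: o_def)
  then have "g x (THE u. \<forall>z. g x u z = h x w (D f x z)) z = h x w (D f x z)" for z
    using riesz_representation[OF inner_product_g[OF x]] by blast
  with tangent_part_unique[OF x, of w "THE u. \<forall>z. g x u z = h x w (D f x z)"]
  show ?thesis by simp
qed

lemma normal_part_normal: "x \<in> U \<Longrightarrow> h x (normal_part fs_metric f x w) (D f x z) = 0"
  by (simp add: normal_part_def h_simps g_tangent_part flip: isometric)

lemma linear_tangent_part:
  assumes x: "x \<in> U"
  shows "linear (tangent_part fs_metric f x)"
proof -
  note gl = inner_product_linear_left[OF inner_product_g[OF x]]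
  show ?thesis
    by (rule linearI; rule inner_product_eqI[OF inner_product_g[OF x]])
      (simp_all add: g_tangent_part[OF x] linear_add[OF gl] linear_scale[OF gl] h_simps)
qed

text \<open>
  The term subtracted in \<open>\<nabla>df\<close> is the tangential part of the ambient derivative, so what is left is
  the normal part.
\<close>

lemma second_fundamental_form_eq_B:
  assumes x: "x \<in> U"
  shows "second_fundamental_form fs_metric f x = B x"
proof (intro ext)
  fix u v
  have "tangent_part fs_metric f x (nabla (\<lambda>y. D f y v) x u) = christoffel g x u v"
    by (rule tangent_part_unique[OF x]) (simp add: christoffel_g[OF x])
  then show "second_fundamental_form fs_metric f x u v = B x u v"
    by (simp add: second_fundamental_form_def normal_part_def B_eq)
qed

lemma metric_trace_sum:
  assumes "x \<in> U"
  shows "\<exists>E. orthonormal_basis (g x) E \<and>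
    (\<forall>b :: real ^ 'm \<Rightarrow> real ^ 'm \<Rightarrow> complex ^ 'n. metric_trace (g x) b = (\<Sum>e\<in>E. b e e))"
  using orthonormal_basis_some[OF inner_product_g[OF assms]] by (auto simp: metric_trace_def)

text \<open>
  The orthonormal bases that define the trace need not depend continuously on the point; the dual
  basis replaces them by smooth data.
\<close>

lemma smooth_on_tau: "smooth_on U tau"
proof (rule smooth_on_transform[OF U])
  show "smooth_on U (\<lambda>x. \<Sum>l\<in>UNIV. \<Sum>k\<in>UNIV. (dual_basis (g x) l $ k) *\<^sub>R B x (axis k 1) (axis l 1))"
    by (intro smooth_on_sum smooth_on_scaleR smooth_on_B smooth_on_linear[OF bounded_linear_vec_nth]
        smooth_on_dual_basis inner_product_g smooth_g U)
  fix x assume x: "x \<in> U"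
  show "tau x = (\<Sum>l\<in>UNIV. \<Sum>k\<in>UNIV. (dual_basis (g x) l $ k) *\<^sub>R B x (axis k 1) (axis l 1))"
    unfolding tension_def
    by (simp add: metric_trace_dual_basis[OF inner_product_g[OF x] linear_B_left[OF x] linear_B_right[OF x]]
        linear_vec_expansion[OF linear_B_left[OF x]])
qed

lemma H_eq: "x \<in> U \<Longrightarrow> H x = (1 / real CARD('m)) *\<^sub>R tau x"
  by (simp add: mean_curvature_def tension_def second_fundamental_form_eq_B)

lemma tau_eq: "x \<in> U \<Longrightarrow> tau x = real CARD('m) *\<^sub>R H x"
  by (simp add: H_eq)

lemma smooth_on_H: "smooth_on U H"
  by (rule smooth_on_transform[OF U smooth_on_scaleR[OF U smooth_on_const smooth_on_tau] H_eq])

lemma tau_normal: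
  assumes x: "x \<in> U"
  shows "h x (tau x) (D f x u) = 0"
proof -
  obtain E where "orthonormal_basis (g x) E"
    and "\<And>b :: real ^ 'm \<Rightarrow> real ^ 'm \<Rightarrow> complex ^ 'n. metric_trace (g x) b = (\<Sum>e\<in>E. b e e)"
    using metric_trace_sum[OF x] by blast
  then show ?thesis
    by (simp add: tension_def h_simps B_normal[OF x])
qed

lemma H_normal: "x \<in> U \<Longrightarrow> h x (H x) (D f x u) = 0"
  by (simp add: H_eq h_simps tau_normal)

subsection \<open>Bitension and the biharmonic identity\<close>

abbreviation "nabla2 \<equiv> second_cov_deriv g fs_metric f"

lemma nabla2_tau:
  assumes x: "x \<in> U"
  shows "nabla2 tau x u v = real CARD('m) *\<^sub>R nabla2 H x u v"
proof -
  have 1: "nabla tau y v = real CARD('m) *\<^sub>R nabla H y v" if "y \<in> U" for y v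
    by (rule nabla_scale[OF smooth_on_H tau_eq that])
  have "nabla (\<lambda>y. nabla tau y v) x u = real CARD('m) *\<^sub>R nabla (\<lambda>y. nabla H y v) x u"
    by (rule nabla_scale[OF smooth_on_nabla[OF smooth_on_H] 1 x])
  then show ?thesis
    by (simp add: second_cov_deriv_def 1[OF x] scaleR_diff_right)
qed

text \<open>
  Both inner products in \<open>curvature_fs_metric\<close> that involve the tension vanish, since the tension
  and its image under the complex structure are normal.
\<close>

lemma curvature_tau:
  assumes x: "x \<in> U" and J: "normal_vector fs_metric f x (complex_structure (H x))"
  shows "curvature fs_metric (f x) (D f x u) (tau x) (D f x u) = - g x u u *\<^sub>R tau x"
proof -
  have "h x (D f x u) (tau x) = 0"
    using tau_normal[OF x, of u] fs_metric_commute by metis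
  moreover have "h x (D f x u) (complex_structure (tau x)) = 0"
    using J fs_metric_commute[of "f x" "D f x u" "complex_structure (H x)"]
    by (simp add: tau_eq[OF x] complex_structure_scaleR h_simps normal_vector_def)
  ultimately show ?thesis
    by (simp add: curvature_fs_metric isometric[OF x])
qed

lemma bitension_eq:
  assumes x: "x \<in> U" and J: "normal_vector fs_metric f x (complex_structure (H x))"
    and E: "orthonormal_basis (g x) E"
    and trace: "\<And>b :: real ^ 'm \<Rightarrow> real ^ 'm \<Rightarrow> complex ^ 'n. metric_trace (g x) b = (\<Sum>e\<in>E. b e e)"
  shows "bitension g fs_metric f x =
    real CARD('m) *\<^sub>R ((\<Sum>e\<in>E. nabla2 H x e e) + real CARD('m) *\<^sub>R H x)"
proof -
  have "(\<Sum>e\<in>E. curvature fs_metric (f x) (D f x e) (tau x) (D f x e)) = (\<Sum>e\<in>E. - 1 *\<^sub>R tau x)"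
    using E by (intro sum.cong) (auto simp: curvature_tau[OF x J] orthonormal_basis_def)
  also have "\<dots> = - real CARD('m) *\<^sub>R tau x"
    using E by (simp add: orthonormal_basis_def sum_constant_scaleR del: sum_constant)
  finally show ?thesis
    unfolding bitension_def rough_laplacian_def trace
    by (simp add: nabla2_tau[OF x] tau_eq[OF x] scaleR_sum_right scaleR_add_right)
qed


text \<open>
  The derivative of \<open>\<langle>\<nabla>\<^sub>u H, H\<rangle>\<close>, which vanishes identically because it is half the derivative of
  \<open>\<langle>H,H\<rangle>\<close>. For the same reason the first-order term of \<open>\<nabla>\<^sup>2 H\<close> is orthogonal to \<open>H\<close>.
\<close>

lemma inner_nabla2_H:
  assumes x: "x \<in> U" and const: "\<And>y. y \<in> U \<Longrightarrow> h y (H y) (H y) = r"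
  shows "h x (nabla2 H x u u) (H x) = - h x (nabla H x u) (nabla H x u)"
proof -
  have 1: "h y (nabla H y v) (H y) = 0" if "y \<in> U" for y v
    using nabla_metric_const[OF smooth_on_H smooth_on_H that const, of v]
    by (simp add: fs_metric_commute[of _ "H y"])
  have "h x (nabla (\<lambda>y. nabla H y u) x u) (H x) + h x (nabla H x u) (nabla H x u) = 0"
    by (rule nabla_metric_const[OF smooth_on_nabla[OF smooth_on_H] smooth_on_H x 1])
  then show ?thesis
    by (simp add: second_cov_deriv_def h_simps 1[OF x])
qed

text \<open>
  Differentiate \<open>\<langle>H, df(v)\<rangle> = 0\<close>. The tangential part of \<open>\<nabla>\<^sub>u df(v)\<close> does not contribute to its
  product with the normal vector \<open>H\<close>.
\<close>

lemma weingarten_B: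
  assumes x: "x \<in> U"
  shows "g x (A x u) v = h x (H x) (B x u v)"
proof -
  have "h x (nabla H x u) (D f x v) + h x (H x) (nabla (\<lambda>y. D f y v) x u) = 0"
    by (rule nabla_metric_const[OF smooth_on_H smooth_on_D[OF smooth_f] x H_normal])
  moreover have "g x (A x u) v = - h x (nabla H x u) (D f x v)"
    unfolding weingarten_def
    by (simp add: linear_neg[OF inner_product_linear_left[OF inner_product_g[OF x]]]
        g_tangent_part[OF x])
  ultimately show ?thesis
    by (simp add: B_eq h_simps H_normal[OF x])
qed

lemma linear_A: "x \<in> U \<Longrightarrow> linear (A x)"
  unfolding weingarten_def
  using linear_compose[OF linear_nabla[OF smooth_on_H] linear_tangent_part]
  by (intro linear_compose_neg) (simp add: o_def)

abbreviation "nperp \<equiv> normal_conn fs_metric f H"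

lemma nabla_H_split: "nabla H x u = nperp x u - D f x (A x u)" if "x \<in> U"
  using linear_neg[OF linear_D_f[OF that]]
  by (simp add: normal_conn_def normal_part_def weingarten_def)

lemma linear_nperp:
  assumes x: "x \<in> U"
  shows "linear (nperp x)"
proof -
  have "linear (\<lambda>u. nabla H x u + D f x (A x u))"
    using linear_compose[OF linear_A[OF x] linear_D_f[OF x]]
    by (intro linear_compose_add linear_nabla smooth_on_H x) (simp add: o_def)
  then show ?thesis
    by (simp add: nabla_H_split[OF x])
qed

lemma norm_nabla_H:
  assumes x: "x \<in> U"
  shows "h x (nabla H x u) (nabla H x u) = g x (A x u) (A x u) + h x (nperp x u) (nperp x u)"
proof -
  have 1: "h x (nperp x u) (D f x v) = 0" for v
    using normal_part_normal[OF x] by (simp add: normal_conn_def)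
  then have 2: "h x (D f x v) (nperp x u) = 0" for v
    by (subst fs_metric_commute)
  show ?thesis
    by (simp add: nabla_H_split[OF x] h_simps isometric[OF x] 1 2)
qed

lemma sum_weingarten:
  assumes x: "x \<in> U"
    and trace: "\<And>b :: real ^ 'm \<Rightarrow> real ^ 'm \<Rightarrow> complex ^ 'n. metric_trace (g x) b = (\<Sum>e\<in>E. b e e)"
  shows "(\<Sum>e\<in>E. g x (A x e) e) = real CARD('m) * h x (H x) (H x)"
proof -
  have "(\<Sum>e\<in>E. g x (A x e) e) = h x (H x) (tau x)"
    by (simp add: weingarten_B[OF x] tension_def trace h_simps)
  then show ?thesis by (simp add: tau_eq[OF x] h_simps)
qed

text \<open>
  The quantitative form of the Cauchy-Schwarz inequality \<open>(trace A)\<^sup>2 \<le> m |A|\<^sup>2\<close>: since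
  \<open>trace A = m r\<close>, the left-hand side measures its failure to be an equality.
\<close>

lemma sum_traceless_weingarten:
  assumes x: "x \<in> U" and E: "orthonormal_basis (g x) E"
    and trace: "\<And>b :: real ^ 'm \<Rightarrow> real ^ 'm \<Rightarrow> complex ^ 'n. metric_trace (g x) b = (\<Sum>e\<in>E. b e e)"
    and r: "h x (H x) (H x) = r"
  shows "(\<Sum>e\<in>E. g x (A x e - r *\<^sub>R e) (A x e - r *\<^sub>R e)) =
    (\<Sum>e\<in>E. g x (A x e) (A x e)) - real CARD('m) * r\<^sup>2"
proof -
  note g = inner_product_g[OF x]
  note simps = linear_diff[OF inner_product_linear_left[OF g]] linear_scale[OF inner_product_linear_left[OF g]]
    linear_diff[OF inner_product_linear_right[OF g]] linear_scale[OF inner_product_linear_right[OF g]]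
  have "(\<Sum>e\<in>E. g x (A x e - r *\<^sub>R e) (A x e - r *\<^sub>R e)) =
      (\<Sum>e\<in>E. g x (A x e) (A x e) - 2 * r * g x (A x e) e + r\<^sup>2)"
  proof (intro sum.cong refl)
    fix e assume "e \<in> E"
    then have "g x e e = 1" using E by (simp add: orthonormal_basis_def)
    moreover have "g x e (A x e) = g x (A x e) e"
      by (rule inner_product_commute[OF g])
    ultimately show "g x (A x e - r *\<^sub>R e) (A x e - r *\<^sub>R e) =
        g x (A x e) (A x e) - 2 * r * g x (A x e) e + r\<^sup>2"
      by (simp add: simps power2_eq_square algebra_simps)
  qed
  also have "\<dots> = (\<Sum>e\<in>E. g x (A x e) (A x e)) - 2 * r * (real CARD('m) * r) + real CARD('m) * r\<^sup>2"
    using E r by (simp add: sum.distrib sum_subtractf sum_weingarten[OF x trace] orthonormal_basis_def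
        flip: sum_distrib_left)
  finally show ?thesis by (simp add: power2_eq_square)
qed

text \<open>
  Take the inner product of the biharmonic equation with \<open>H\<close> and split \<open>|\<nabla>H|\<^sup>2\<close> into its tangential
  and normal parts.
\<close>

lemma biharmonic_identity:
  assumes x: "x \<in> U" and J: "normal_vector fs_metric f x (complex_structure (H x))"
    and const: "\<And>y. y \<in> U \<Longrightarrow> h y (H y) (H y) = r"
    and bi: "bitension g fs_metric f x = 0"
  obtains E where "orthonormal_basis (g x) E"
    and "real CARD('m) * (r * (1 - r)) =
      (\<Sum>e\<in>E. g x (A x e - r *\<^sub>R e) (A x e - r *\<^sub>R e) + h x (nperp x e) (nperp x e))"
proof -
  obtain E where E: "orthonormal_basis (g x) E"
    and trace: "\<And>b :: real ^ 'm \<Rightarrow> real ^ 'm \<Rightarrow> complex ^ 'n. metric_trace (g x) b = (\<Sum>e\<in>E. b e e)"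
    using metric_trace_sum[OF x] by blast
  have "(\<Sum>e\<in>E. nabla2 H x e e) + real CARD('m) *\<^sub>R H x = 0"
    using bi unfolding bitension_eq[OF x J E trace] by simp
  then have "h x ((\<Sum>e\<in>E. nabla2 H x e e) + real CARD('m) *\<^sub>R H x) (H x) = 0"
    by (simp add: h_simps)
  then have "(\<Sum>e\<in>E. h x (nabla H x e) (nabla H x e)) = real CARD('m) * r"
    by (simp add: h_simps inner_nabla2_H[OF x const] sum_negf const[OF x])
  then have "real CARD('m) * r = (\<Sum>e\<in>E. g x (A x e) (A x e)) + (\<Sum>e\<in>E. h x (nperp x e) (nperp x e))"
    by (simp add: norm_nabla_H[OF x] sum.distrib)
  then have "real CARD('m) * (r * (1 - r)) =
      (\<Sum>e\<in>E. g x (A x e - r *\<^sub>R e) (A x e - r *\<^sub>R e)) + (\<Sum>e\<in>E. h x (nperp x e) (nperp x e))"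
    unfolding sum_traceless_weingarten[OF x E trace const[OF x]]
    by (simp add: algebra_simps power2_eq_square)
  then show ?thesis
    using that[OF E] by (simp add: sum.distrib)
qed

lemma g_nonneg: "x \<in> U \<Longrightarrow> g x u u \<ge> 0"
  by (rule inner_product_ge_0[OF inner_product_g])

lemma h_nonneg: "h x w w \<ge> 0"
  by (rule inner_product_ge_0[OF inner_product_fs_metric])

lemma biharmonic_imp_le_1:
  assumes x: "x \<in> U" and J: "normal_vector fs_metric f x (complex_structure (H x))"
    and const: "\<And>y. y \<in> U \<Longrightarrow> h y (H y) (H y) = r" and r: "r > 0"
    and bi: "bitension g fs_metric f x = 0"
  shows "r \<le> 1"
proof -
  obtain E where "orthonormal_basis (g x) E" and "real CARD('m) * (r * (1 - r)) =
      (\<Sum>e\<in>E. g x (A x e - r *\<^sub>R e) (A x e - r *\<^sub>R e) + h x (nperp x e) (nperp x e))"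
    by (rule biharmonic_identity[OF x J const bi])
  note this(2)
  also have "\<dots> \<ge> 0"
    by (intro sum_nonneg add_nonneg_nonneg g_nonneg h_nonneg x)
  finally show ?thesis
    using r by (simp add: zero_le_mult_iff)
qed

lemma biharmonic_imp_umbilical_parallel:
  assumes x: "x \<in> U" and J: "normal_vector fs_metric f x (complex_structure (H x))"
    and const: "\<And>y. y \<in> U \<Longrightarrow> h y (H y) (H y) = 1"
    and bi: "bitension g fs_metric f x = 0"
  shows "A x u = u" and "nperp x u = 0"
proof -
  obtain E where E: "orthonormal_basis (g x) E" and "real CARD('m) * (1 * (1 - 1)) =
      (\<Sum>e\<in>E. g x (A x e - 1 *\<^sub>R e) (A x e - 1 *\<^sub>R e) + h x (nperp x e) (nperp x e))"
    by (rule biharmonic_identity[OF x J const bi])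
  then have sum: "(\<Sum>e\<in>E. g x (A x e - e) (A x e - e) + h x (nperp x e) (nperp x e)) = 0"
    by simp
  have nonneg: "0 \<le> g x (A x e - e) (A x e - e)" "0 \<le> h x (nperp x e) (nperp x e)" for e
    by (intro g_nonneg h_nonneg x)+
  have zero: "A x e - e = 0" "nperp x e = 0" if "e \<in> E" for e
  proof -
    have "g x (A x e - e) (A x e - e) + h x (nperp x e) (nperp x e) = 0"
      using sum that nonneg sum_nonneg_eq_0_iff[OF orthonormal_basis_finite[OF E],
          of "\<lambda>e. g x (A x e - e) (A x e - e) + h x (nperp x e) (nperp x e)"] by simp
    then have "g x (A x e - e) (A x e - e) = 0" "h x (nperp x e) (nperp x e) = 0"
      using nonneg[of e] by linarith+
    then show "A x e - e = 0" "nperp x e = 0"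
      using inner_product_eq_0[OF inner_product_g[OF x]] inner_product_eq_0[OF inner_product_fs_metric]
      by blast+
  qed
  have lin: "linear (\<lambda>u. A x u - u)"
    by (intro linear_compose_sub linear_A x) (simp add: linear_iff)
  have "A x u - u = 0"
    using orthonormal_parseval[OF inner_product_g[OF x] E lin, of u] zero(1) by simp
  then show "A x u = u" by simp
  show "nperp x u = 0"
    using orthonormal_parseval[OF inner_product_g[OF x] E linear_nperp[OF x], of u] zero(2) by simp
qed

text \<open>
  Here \<open>\<nabla>H = - df\<close> on the whole chart, so that this equation may be differentiated once more.
\<close>

lemma umbilical_parallel_imp_biharmonic:
  assumes x: "x \<in> U" and J: "normal_vector fs_metric f x (complex_structure (H x))"
    and umb: "\<And>y u. y \<in> U \<Longrightarrow> A y u = u" and par: "\<And>y u. y \<in> U \<Longrightarrow> nperp y u = 0"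
  shows "bitension g fs_metric f x = 0"
proof -
  obtain E where E: "orthonormal_basis (g x) E"
    and trace: "\<And>b :: real ^ 'm \<Rightarrow> real ^ 'm \<Rightarrow> complex ^ 'n. metric_trace (g x) b = (\<Sum>e\<in>E. b e e)"
    using metric_trace_sum[OF x] by blast
  have 1: "nabla H y u = (- 1) *\<^sub>R D f y u" if "y \<in> U" for y u
    by (simp add: nabla_H_split[OF that] umb[OF that] par[OF that])
  have "nabla (\<lambda>y. nabla H y v) x u = (- 1) *\<^sub>R nabla (\<lambda>y. D f y v) x u" for u v
    by (rule nabla_scale[OF smooth_on_D[OF smooth_f] 1 x])
  then have "nabla2 H x u v = - B x u v" for u v
    by (simp add: second_cov_deriv_def 1[OF x] B_eq)
  then have "(\<Sum>e\<in>E. nabla2 H x e e) = - tau x"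
    by (simp add: tension_def trace sum_negf)
  then show ?thesis
    by (simp add: bitension_eq[OF x J E trace] tau_eq[OF x])
qed

end

section \<open>Global statement\<close>

lemma in_charts_complex_projective_space:
  fixes M :: "('a::euclidean_space, 'p) manifold" and \<phi> :: "'p \<Rightarrow> 'n::finite hom_coords set"
  shows "in_charts M complex_projective_space \<phi> P \<longleftrightarrow>
    (\<forall>k\<in>M. \<forall>d\<in>complex_projective_space. \<forall>x\<in>coord_dom k d \<phi>.
      P (chart_met k) fs_metric (coord_rep k d \<phi>) x)"
proof -
  have "chart_met d = fs_metric" if "d \<in> complex_projective_space"
    for d :: "(complex ^ 'n, 'n hom_coords set) chart"
    using that by (auto simp: complex_projective_space_def chart_met_affine_chart)
  then show ?thesis
    unfolding in_charts_def by (intro ball_cong refl) simp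
qed

theorem proposition2p8:
  fixes M :: "(real ^ 'm, 'n::finite hom_coords set) manifold" and c :: real
  assumes "riemannian_submanifold M complex_projective_space"
    and "points M \<noteq> {}"
    and "J_mean_curvature_normal M"
    and "constant_mean_curvature M complex_projective_space c"
    and "c \<noteq> 0"
  shows "(proper_biharmonic_submanifold M complex_projective_space \<longrightarrow> c\<^sup>2 \<in> {0<..1}) \<and>
    (c\<^sup>2 = 1 \<longrightarrow>
      (proper_biharmonic_submanifold M complex_projective_space \<longleftrightarrow>
        pseudo_umbilical M complex_projective_space \<and>
        parallel_mean_curvature M complex_projective_space))"
proof -
  let ?N = "complex_projective_space :: (complex ^ 'n, 'n hom_coords set) manifold"
  note charts = in_charts_complex_projective_space
  have local: "immersion_into_cpn (chart_met k) (coord_rep k d id) (coord_dom k d id)"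
    if k: "k \<in> M" and d: "d \<in> ?N" for k d
  proof
    have sub: "coord_dom k d id \<subseteq> chart_dom k"
      by (auto simp: coord_dom_def)
    have M: "riemannian_manifold M" "smooth_map M ?N id" "isometric M ?N id"
      using assms(1) by (auto simp: riemannian_submanifold_def)
    show "open (coord_dom k d id)" "smooth_on (coord_dom k d id) (coord_rep k d id)"
      using M(2) k d by (auto simp: smooth_map_def)
    show "inner_product (chart_met k x)" if "x \<in> coord_dom k d id" for x
      using M(1) k sub that by (auto simp: riemannian_manifold_def)
    have "smooth_on (chart_dom k) (\<lambda>x. chart_met k x u v)" for u v
      using M(1) k by (auto simp: riemannian_manifold_def)
    then show "smooth_on (coord_dom k d id) (\<lambda>x. chart_met k x u v)" for u v
      using sub by (rule smooth_on_subset)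
    show "chart_met k x u v =
        fs_metric (coord_rep k d id x) (D (coord_rep k d id) x u) (D (coord_rep k d id) x v)"
      if "x \<in> coord_dom k d id" for x u v
      using M(3) k d that by (auto simp: isometric_def charts)
  qed
  have J: "normal_vector fs_metric (coord_rep k d id) x
      (complex_structure (mean_curvature (chart_met k) fs_metric (coord_rep k d id) x))"
    if "k \<in> M" "d \<in> ?N" "x \<in> coord_dom k d id" for k d x
    using assms(3) that by (simp add: J_mean_curvature_normal_def charts)
  have norm: "mean_curvature_norm (chart_met k) fs_metric (coord_rep k d id) x = c"
    if "k \<in> M" "d \<in> ?N" "x \<in> coord_dom k d id" for k d x
    using assms(4) that by (simp add: constant_mean_curvature_def charts)
  have const: "fs_metric (coord_rep k d id x) (mean_curvature (chart_met k) fs_metric (coord_rep k d id) x)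
      (mean_curvature (chart_met k) fs_metric (coord_rep k d id) x) = c\<^sup>2"
    if "k \<in> M" "d \<in> ?N" "x \<in> coord_dom k d id" for k d x
    using norm[OF that] real_sqrt_pow2[OF inner_product_ge_0[OF inner_product_fs_metric]]
    unfolding mean_curvature_norm_def by metis
  obtain k d x where pt: "k \<in> M" "d \<in> ?N" "x \<in> coord_dom k d id"
  proof -
    have "points M \<subseteq> points ?N" using assms(1) by (simp add: riemannian_submanifold_def)
    with assms(2) obtain p where "p \<in> points M" "p \<in> points ?N" by blast
    with that show ?thesis by (force simp: points_def coord_dom_def)
  qed
  have not_harmonic: "\<not> harmonic_map M ?N id"
  proof
    assume "harmonic_map M ?N id"
    then have "tension (chart_met k) fs_metric (coord_rep k d id) x = 0"
      using pt by (simp add: harmonic_map_def charts)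
    then have "mean_curvature (chart_met k) fs_metric (coord_rep k d id) x = 0"
      using immersion_into_cpn.H_eq[OF local[OF pt(1,2)] pt(3)] by simp
    then have "c\<^sup>2 = 0"
      using const[OF pt] linear_0[OF fs_metric_linear_left] by metis
    with assms(5) show False by simp
  qed
  have proper: "proper_biharmonic_submanifold M ?N \<longleftrightarrow>
      (\<forall>k\<in>M. \<forall>d\<in>?N. \<forall>x\<in>coord_dom k d id. bitension (chart_met k) fs_metric (coord_rep k d id) x = 0)"
    using not_harmonic
    by (simp add: proper_biharmonic_submanifold_def proper_biharmonic_map_def biharmonic_map_def charts)
  show ?thesis
  proof (intro conjI impI)
    assume "proper_biharmonic_submanifold M ?N"
    then have "bitension (chart_met k) fs_metric (coord_rep k d id) x = 0"
      using pt by (simp add: proper)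
    then have "c\<^sup>2 \<le> 1"
      using immersion_into_cpn.biharmonic_imp_le_1[OF local[OF pt(1,2)] pt(3) J[OF pt] const[OF pt(1,2)]]
        assms(5) by simp
    then show "c\<^sup>2 \<in> {0<..1}" using assms(5) by simp
  next
    assume c: "c\<^sup>2 = 1"
    have umb: "pseudo_umbilical M ?N \<longleftrightarrow> (\<forall>k\<in>M. \<forall>d\<in>?N. \<forall>x\<in>coord_dom k d id. \<forall>u.
        weingarten fs_metric (coord_rep k d id)
          (mean_curvature (chart_met k) fs_metric (coord_rep k d id)) x u = u)"
      using norm c by (simp add: pseudo_umbilical_def charts)
    have par: "parallel_mean_curvature M ?N \<longleftrightarrow> (\<forall>k\<in>M. \<forall>d\<in>?N. \<forall>x\<in>coord_dom k d id. \<forall>u.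
        normal_conn fs_metric (coord_rep k d id)
          (mean_curvature (chart_met k) fs_metric (coord_rep k d id)) x u = 0)"
      by (simp add: parallel_mean_curvature_def charts)
    show "proper_biharmonic_submanifold M ?N \<longleftrightarrow> pseudo_umbilical M ?N \<and> parallel_mean_curvature M ?N"
    proof
      assume "proper_biharmonic_submanifold M ?N"
      then show "pseudo_umbilical M ?N \<and> parallel_mean_curvature M ?N"
        unfolding umb par proper
        using immersion_into_cpn.biharmonic_imp_umbilical_parallel[OF local _ J] const c by simp
    next
      assume "pseudo_umbilical M ?N \<and> parallel_mean_curvature M ?N"
      then show "proper_biharmonic_submanifold M ?N"
        unfolding umb par proper
        using immersion_into_cpn.umbilical_parallel_imp_biharmonic[OF local _ J] by simp
    qed
  qed
qed

end
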